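(* Let $L,a>0$, let $R=[0,L]_x\times[0,a]_y$, and let $\Omega\subset\mathbb{R}^2$ be the Bunimovich stadium associated to the rectangle $R$. Let $R_1=[\alpha,\beta]_x\times[0,a]_y$ with $0<\alpha<\beta<L$; that is, $R_1$ is a rectangle strictly contained in $R$, with its horizontal sides contained in the horizontal sides of $R$, and such that $R\setminus R_1$ has two components. Then there exists a constant $C$, depending only on $\Omega$ and $R_1$, such that for every $\lambda\ge 0$, every $f\in L^2(\Omega)$ and every solution $v\in H^1_0(\Omega)$ of $$(-\Delta-\lambda^2)v=f \ \text{ in } \Omega,\qquad v|_{\partial\Omega}=0,$$ one has $$\int_\Omega |v(x,y)|^2\,dx\,dy\le C\left(\int_\Omega |f(x,y)|^2\,dx\,dy+\int_{\Omega\setminus R_1}|v(x,y)|^2\,dx\,dy\right).$$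
   Context: $\Delta=\partial_x^2+\partial_y^2$. The Bunimovich stadium associated to the rectangle $R=[0,L]_x\times[0,a]_y$ is the planar region $\Omega$ obtained by adding two circular "wings" to $R$: $\Omega$ is the interior of the union of $R$ and the two closed discs of radius $a/2$ centred at $(0,a/2)$ and $(L,a/2)$. Here $x$ is the horizontal direction and $y$ the vertical one, so the horizontal sides $[0,L]\times\{0\}$ and $[0,L]\times\{a\}$ of $R$ are the straight parts of $\partial\Omega$. Functions are complex-valued; the equation is understood in the sense of distributions in $\Omega$, and the Dirichlet boundary condition is encoded by $v\in H^1_0(\Omega)$. *)

theory Defs
  imports "HOL-Analysis.Analysis"
begin

definition stadium :: "real \<Rightarrow> real \<Rightarrow> (real \<times> real) set" where
  "stadium L a =
     interior ({0..L} \<times> {0..a} \<union> cball (0, a / 2) (a / 2) \<union> cball (L, a / 2) (a / 2))"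

text \<open>Elements of \<open>L2 \<Omega>\<close> are representatives: total functions whose values outside \<open>\<Omega>\<close> are
  irrelevant, since all integrals below are taken over \<open>lebesgue_on \<Omega>\<close>.\<close>

definition L2 :: "(real \<times> real) set \<Rightarrow> (real \<times> real \<Rightarrow> complex) set" where
  "L2 \<Omega> = {f. f \<in> borel_measurable (lebesgue_on \<Omega>) \<and>
               integrable (lebesgue_on \<Omega>) (\<lambda>z. (cmod (f z))\<^sup>2)}"

definition dx :: "(real \<times> real \<Rightarrow> complex) \<Rightarrow> real \<times> real \<Rightarrow> complex" where
  "dx \<phi> z = vector_derivative (\<lambda>t. \<phi> (t, snd z)) (at (fst z))"

definition dy :: "(real \<times> real \<Rightarrow> complex) \<Rightarrow> real \<times> real \<Rightarrow> complex" where
  "dy \<phi> z = vector_derivative (\<lambda>t. \<phi> (fst z, t)) (at (snd z))"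

definition laplacian :: "(real \<times> real \<Rightarrow> complex) \<Rightarrow> real \<times> real \<Rightarrow> complex" where
  "laplacian \<phi> z = dx (dx \<phi>) z + dy (dy \<phi>) z"

primrec Ck :: "nat \<Rightarrow> (real \<times> real \<Rightarrow> complex) \<Rightarrow> bool" where
  "Ck 0 \<phi> \<longleftrightarrow> continuous_on UNIV \<phi>"
| "Ck (Suc k) \<phi> \<longleftrightarrow> (\<forall>z. \<phi> differentiable (at z)) \<and> Ck k (dx \<phi>) \<and> Ck k (dy \<phi>)"

definition test_functions :: "(real \<times> real) set \<Rightarrow> (real \<times> real \<Rightarrow> complex) set" where
  "test_functions \<Omega> = {\<phi>. (\<forall>k. Ck k \<phi>) \<and>
     compact (closure {z. \<phi> z \<noteq> 0}) \<and> closure {z. \<phi> z \<noteq> 0} \<subseteq> \<Omega>}"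

definition has_weak_gradient ::
  "(real \<times> real) set \<Rightarrow> (real \<times> real \<Rightarrow> complex) \<Rightarrow>
     (real \<times> real \<Rightarrow> complex) \<Rightarrow> (real \<times> real \<Rightarrow> complex) \<Rightarrow> bool" where
  "has_weak_gradient \<Omega> v gx gy \<longleftrightarrow> (\<forall>\<phi>\<in>test_functions \<Omega>.
     (\<integral>z. v z * dx \<phi> z \<partial>lebesgue_on \<Omega>) = - (\<integral>z. gx z * \<phi> z \<partial>lebesgue_on \<Omega>) \<and>
     (\<integral>z. v z * dy \<phi> z \<partial>lebesgue_on \<Omega>) = - (\<integral>z. gy z * \<phi> z \<partial>lebesgue_on \<Omega>))"

text \<open>The closure of the test functions in the Sobolev space \<open>H\<^sup>1(\<Omega>)\<close>, for \<open>\<Omega>\<close> open.\<close>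

definition H10 :: "(real \<times> real) set \<Rightarrow> (real \<times> real \<Rightarrow> complex) set" where
  "H10 \<Omega> = {v \<in> L2 \<Omega>. \<exists>gx\<in>L2 \<Omega>. \<exists>gy\<in>L2 \<Omega>. has_weak_gradient \<Omega> v gx gy \<and>
     (\<exists>\<phi>. (\<forall>n::nat. \<phi> n \<in> test_functions \<Omega>) \<and>
       (\<lambda>n. (\<integral>z. (cmod (\<phi> n z - v z))\<^sup>2 \<partial>lebesgue_on \<Omega>)
          + (\<integral>z. (cmod (dx (\<phi> n) z - gx z))\<^sup>2 \<partial>lebesgue_on \<Omega>)
          + (\<integral>z. (cmod (dy (\<phi> n) z - gy z))\<^sup>2 \<partial>lebesgue_on \<Omega>)) \<longlonglongrightarrow> 0)}"

text \<open>\<open>(-\<Delta> - k\<^sup>2) v = f\<close> in the sense of distributions in \<open>\<Omega>\<close>; the pairing with test functions is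
  bilinear (no complex conjugation).\<close>

definition helmholtz_distributional ::
  "(real \<times> real) set \<Rightarrow> real \<Rightarrow> (real \<times> real \<Rightarrow> complex) \<Rightarrow> (real \<times> real \<Rightarrow> complex) \<Rightarrow> bool" where
  "helmholtz_distributional \<Omega> k v f \<longleftrightarrow> (\<forall>\<phi>\<in>test_functions \<Omega>.
     (\<integral>z. v z * (- laplacian \<phi> z - (complex_of_real k)\<^sup>2 * \<phi> z) \<partial>lebesgue_on \<Omega>)
       = (\<integral>z. f z * \<phi> z \<partial>lebesgue_on \<Omega>))"

end

theory Submission
  imports Defs
begin

text \<open>
  Expand in the modes \<open>sin (n \<pi> y / a)\<close> on the rectangle and argue by duality. If
  \<open>-\<psi>'' - \<mu> \<psi> = g\<close> on \<open>[0,L]\<close>, then \<open>\<psi>\<close> can be chosen with \<open>\<psi>\<close> and \<open>\<psi>'\<close> bounded by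
  \<open>\<integral>|g|\<close>, uniformly in the real number \<open>\<mu>\<close>. Hence for a finite sum of modes \<open>g\<close> there is
  \<open>\<Phi>\<close>, vanishing on the horizontal sides, with \<open>-\<Delta>\<Phi> - k\<^sup>2 \<Phi> = g\<close> and with the norms of \<open>\<Phi>\<close> and
  \<open>\<partial>\<^sub>x \<Phi>\<close> bounded by that of \<open>g\<close>, uniformly in \<open>k\<close>. Let \<open>\<eta>(x)\<close> be a cutoff that equals 1 near
  \<open>[\<alpha>,\<beta>]\<close>. Testing the equation for \<open>v\<close> against \<open>\<eta> \<Phi>\<close> gives
  \<open>\<integral> v \<eta> g = \<integral> f \<eta> \<Phi> + \<integral> v (\<eta>'' \<Phi> + 2 \<eta>' \<partial>\<^sub>x \<Phi>)\<close>, where the last integrand lives outside \<open>R\<^sub>1\<close>.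
  The conjugates of the test functions approximating \<open>v\<close> are uniform limits of such sums \<open>g\<close>
  on the rectangle, so \<open>\<integral> \<eta> |v|\<^sup>2\<close> is controlled. No regularity of \<open>v\<close> beyond \<open>H\<^sup>1\<^sub>0\<close> enters: it is
  only needed that \<open>v\<close> has zero trace on the horizontal sides, so that \<open>\<eta> \<Phi>\<close>, which is not
  compactly supported in \<open>\<Omega>\<close>, is an admissible test function.
\<close>

subsection \<open>Smooth functions of one variable\<close>

text \<open>Uniformity in \<open>k\<close> is possible because nothing is prescribed for \<psi> at
  \<open>x = L\<close>: a boundary value problem would have resonances, whereas the cutoff \<eta>
  removes \<Phi> near both vertical ends and leaves the choice of solution free. The parameter is
  \<open>\<mu> = k\<^sup>2 - (n * pi / a)\<^sup>2\<close>, which has either sign and may be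
  arbitrarily close to 0, so the one-dimensional bound has to cover growth, oscillation and the
  degenerate case at once. In \<open>x\<close>, the commutator with \<eta> costs one derivative of
  \<Phi>, which is why the derivative of \<psi> must be bounded as well. In \<open>y\<close>, the
  second derivative of a cutoff at the sides is unbounded; one derivative is therefore moved onto
  the weak gradient of \<open>v\<close> before the limit, and moved back afterwards on the full
  sine. The wings enter through their lying in the strip between the horizontal sides. Constants are
  arranged for absorption: the factor 1/16 of the squared norm of \<open>g\<close> becomes 1/8 of
  that of a test function and finally 1/2 of that of \<open>v\<close>.\<close>

primrec Ck1 :: "nat \<Rightarrow> (real \<Rightarrow> complex) \<Rightarrow> bool" where
  "Ck1 0 f \<longleftrightarrow> continuous_on UNIV f"
| "Ck1 (Suc k) f \<longleftrightarrow> (\<exists>f'. (\<forall>x. (f has_vector_derivative f' x) (at x)) \<and> Ck1 k f')"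

definition smooth1 :: "(real \<Rightarrow> complex) \<Rightarrow> bool" where
  "smooth1 f \<longleftrightarrow> (\<forall>k. Ck1 k f)"

lemma continuous_on_vector_derivative:
  fixes f :: "real \<Rightarrow> 'a::real_normed_vector"
  assumes "\<And>x. (f has_vector_derivative f' x) (at x)"
  shows "continuous_on S f"
  using assms by (meson continuous_at_imp_continuous_on has_vector_derivative_continuous)

lemma Ck1_Suc_intro:
  "(\<And>x. (f has_vector_derivative f' x) (at x)) \<Longrightarrow> Ck1 k f' \<Longrightarrow> Ck1 (Suc k) f"
  by auto

lemma Ck1_SucD: "Ck1 (Suc k) f \<Longrightarrow> Ck1 k f"
proof (induction k arbitrary: f)
  case 0
  then show ?case by (auto intro: continuous_on_vector_derivative)
next
  case (Suc k)
  then obtain f' where "\<And>x. (f has_vector_derivative f' x) (at x)" "Ck1 (Suc k) f'"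
    by (auto simp del: Ck1.simps(1))
  with Suc.IH show ?case by auto
qed

lemma smooth1_intro:
  assumes "\<And>x. (f has_vector_derivative f' x) (at x)" "smooth1 f'"
  shows "smooth1 f"
  unfolding smooth1_def
proof
  fix k show "Ck1 k f"
    using assms by (cases k) (auto simp: smooth1_def intro: continuous_on_vector_derivative)
qed

text \<open>\<open>Ck1\<close> only asserts that some derivative exists, so the witness could a
  priori depend on \<open>k\<close>; uniqueness of derivatives identifies every witness with
  \<open>f'\<close>.\<close>

lemma smooth1_deriv:
  assumes "smooth1 f" and "\<And>x. (f has_vector_derivative f' x) (at x)"
  shows "smooth1 f'"
  unfolding smooth1_def
proof
  fix k
  have "Ck1 (Suc k) f" using assms(1) by (simp only: smooth1_def)
  then obtain g where g: "\<And>x. (f has_vector_derivative g x) (at x)" "Ck1 k g" by auto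
  have "g = f'"
    using g(1) assms(2) vector_derivative_unique_at by (intro ext) blast
  then show "Ck1 k f'" using g(2) by simp
qed

lemma smooth1E:
  assumes "smooth1 f"
  obtains f' where "\<And>x. (f has_vector_derivative f' x) (at x)" "smooth1 f'"
proof -
  have "Ck1 (Suc 0) f" using assms by (simp only: smooth1_def)
  then show ?thesis using that smooth1_deriv[OF assms] by (metis Ck1.simps(2))
qed

lemma smooth1_continuous: "smooth1 f \<Longrightarrow> continuous_on S f"
  by (metis Ck1.simps(1) continuous_on_subset smooth1_def subset_UNIV)

lemma Ck1_const: "Ck1 k (\<lambda>x. c)"
  by (induction k arbitrary: c) (auto intro!: exI[of _ "\<lambda>x. 0"])

lemma Ck1_add: "Ck1 k f \<Longrightarrow> Ck1 k g \<Longrightarrow> Ck1 k (\<lambda>x. f x + g x)"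
proof (induction k arbitrary: f g)
  case (Suc k)
  then obtain f' g' where "\<And>x. (f has_vector_derivative f' x) (at x)" "Ck1 k f'"
    "\<And>x. (g has_vector_derivative g' x) (at x)" "Ck1 k g'" by auto
  with Suc.IH[of f' g'] show ?case
    by (auto intro!: exI[of _ "\<lambda>x. f' x + g' x"] has_vector_derivative_add)
qed (auto intro: continuous_intros)

lemma Ck1_mult: "Ck1 k f \<Longrightarrow> Ck1 k g \<Longrightarrow> Ck1 k (\<lambda>x. f x * g x)"
proof (induction k arbitrary: f g)
  case (Suc k)
  then obtain f' g' where *: "\<And>x. (f has_vector_derivative f' x) (at x)" "Ck1 k f'"
    "\<And>x. (g has_vector_derivative g' x) (at x)" "Ck1 k g'" by auto
  moreover have "Ck1 k f" "Ck1 k g" using Suc.prems Ck1_SucD by blast+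
  ultimately have "Ck1 k (\<lambda>x. f x * g' x + f' x * g x)"
    by (intro Ck1_add Suc.IH)
  with * show ?case
    by (auto intro!: exI[of _ "\<lambda>x. f x * g' x + f' x * g x"] has_vector_derivative_mult)
qed (auto intro: continuous_intros)

lemma Ck1_affine: "Ck1 k f \<Longrightarrow> Ck1 k (\<lambda>x. f (p * x + q))"
proof (induction k arbitrary: f)
  case 0
  then have "continuous_on UNIV (\<lambda>x. f (p * x + q))"
    by (auto intro!: continuous_on_compose2[of UNIV f] continuous_intros)
  then show ?case by simp
next
  case (Suc k)
  then obtain f' where f': "\<And>x. (f has_vector_derivative f' x) (at x)" "Ck1 k f'" by auto
  have "((\<lambda>x. f (p * x + q)) has_vector_derivative of_real p * f' (p * x + q)) (at x)" for x
  proof -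
    have "((\<lambda>x. p * x + q) has_vector_derivative p) (at x)"
      by (auto intro!: derivative_eq_intros simp flip: has_real_derivative_iff_has_vector_derivative)
    from vector_diff_chain_at[OF this f'(1)] show ?thesis
      by (simp add: o_def scaleR_conv_of_real)
  qed
  moreover have "Ck1 k (\<lambda>x. of_real p * f' (p * x + q))"
    by (intro Ck1_mult Ck1_const Suc.IH f'(2))
  ultimately show ?case by (rule Ck1_Suc_intro)
qed

lemma smooth1_const [intro]: "smooth1 (\<lambda>x. c)"
  and smooth1_add [intro]: "smooth1 f \<Longrightarrow> smooth1 g \<Longrightarrow> smooth1 (\<lambda>x. f x + g x)"
  and smooth1_mult [intro]: "smooth1 f \<Longrightarrow> smooth1 g \<Longrightarrow> smooth1 (\<lambda>x. f x * g x)"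
  and smooth1_affine: "smooth1 f \<Longrightarrow> smooth1 (\<lambda>x. f (p * x + q))"
  by (auto simp: smooth1_def intro: Ck1_const Ck1_add Ck1_mult Ck1_affine)

text \<open>Bootstrapping: \<open>c * f x + g x\<close> is as regular as \<open>f\<close>, hence
  \<open>f\<close> gains one order at each step. This gives smoothness of exponentials and of the
  solutions \<open>w\<close> and \<open>z\<close> of first-order equations without differentiating
  formulas.\<close>

lemma smooth1_linear_ode:
  assumes "\<And>x. (f has_vector_derivative c * f x + g x) (at x)" "smooth1 g"
  shows "smooth1 f"
  unfolding smooth1_def
proof
  fix k show "Ck1 k f"
  proof (induction k)
    case 0 show ?case using continuous_on_vector_derivative[of f, OF assms(1)] by simp
  next
    case (Suc k)
    have "Ck1 k (\<lambda>x. c * f x + g x)"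
      using Suc assms(2) unfolding smooth1_def by (intro Ck1_add Ck1_mult Ck1_const) auto
    with assms(1) show ?case by (rule Ck1_Suc_intro)
  qed
qed

lemma smooth1_id: "smooth1 of_real"
  using smooth1_const[of 1]
  by (rule smooth1_intro[rotated]) (auto intro!: derivative_eq_intros)

lemma has_vector_derivative_exp_of_real:
  "((\<lambda>x. exp (c * of_real x)) has_vector_derivative c * exp (c * of_real x)) (at x)" for c :: complex
proof -
  have "((\<lambda>z. exp (c * z)) has_field_derivative c * exp (c * of_real x)) (at (of_real x))"
    by (auto intro!: derivative_eq_intros)
  from has_vector_derivative_real_field[OF this] show ?thesis by simp
qed

lemma smooth1_exp: "smooth1 (\<lambda>x. exp (c * of_real x))"
  by (rule smooth1_linear_ode[where c=c and g="\<lambda>x. 0"])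
    (use has_vector_derivative_exp_of_real in auto)

text \<open>Each function is the derivative of the other up to a factor, so the induction has to
  carry both.\<close>

lemma Ck1_sin_cos: "Ck1 k (\<lambda>x. of_real (sin (c * x))) \<and> Ck1 k (\<lambda>x. of_real (cos (c * x)))"
proof (induction k)
  case 0 show ?case by (auto intro!: continuous_intros)
next
  case (Suc k)
  have "((\<lambda>x. complex_of_real (sin (c * x))) has_vector_derivative of_real c * of_real (cos (c * x))) (at x)"
    "((\<lambda>x. complex_of_real (cos (c * x))) has_vector_derivative of_real (-c) * of_real (sin (c * x))) (at x)" for x
    by (subst of_real_mult[symmetric], rule has_vector_derivative_of_real,
        auto intro!: derivative_eq_intros simp flip: has_real_derivative_iff_has_vector_derivative)+
  moreover have "Ck1 k (\<lambda>x. of_real c * of_real (cos (c * x)))"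
    "Ck1 k (\<lambda>x. of_real (-c) * of_real (sin (c * x)))"
    using Suc by (intro Ck1_mult Ck1_const; simp)+
  ultimately show ?case by (intro conjI Ck1_Suc_intro)
qed

lemma smooth1_sin: "smooth1 (\<lambda>x. of_real (sin (c * x)))"
  using Ck1_sin_cos by (auto simp: smooth1_def)

section \<open>Flat functions and the smooth step\<close>

text \<open>All derivatives of \<open>exp (-1/x)\<close>, extended by zero, are of this form.\<close>

definition flat_exp :: "real poly \<Rightarrow> real \<Rightarrow> real" where
  "flat_exp P x = (if x > 0 then poly P (1 / x) * exp (- (1 / x)) else 0)"

lemma tendsto_poly_exp_at_top: "((\<lambda>t. poly P t * exp (- t)) \<longlongrightarrow> 0) at_top" for P :: "real poly"
proof -
  have "((\<lambda>t. \<Sum>i\<le>degree P. coeff P i * (t ^ i / exp t)) \<longlongrightarrow> (\<Sum>i\<le>degree P. coeff P i * 0)) at_top"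
    by (intro tendsto_intros tendsto_power_div_exp_0)
  then show ?thesis
    by (simp add: poly_altdef sum_distrib_right sum_divide_distrib exp_minus divide_inverse mult.assoc)
qed

text \<open>In the variable \<open>t = 1 / x\<close> the limit from the right is that of
  \<open>poly P t * exp (- t)\<close> at infinity; on the left the function is zero.\<close>

lemma tendsto_flat_exp: "(flat_exp P \<longlongrightarrow> 0) (at 0)"
proof -
  have "((\<lambda>x. poly P (inverse x) * exp (- inverse x)) \<longlongrightarrow> 0) (at_right 0)"
    using tendsto_poly_exp_at_top filterlim_inverse_at_top_right by (rule filterlim_compose)
  then have "(flat_exp P \<longlongrightarrow> 0) (at_right 0)"
    by (rule Lim_transform_eventually)
      (auto simp: eventually_at_filter flat_exp_def divide_inverse)
  moreover have "(flat_exp P \<longlongrightarrow> 0) (at_left 0)"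
    by (rule Lim_transform_eventually[OF tendsto_const])
      (auto simp: eventually_at_filter flat_exp_def)
  ultimately show ?thesis by (simp add: filterlim_split_at)
qed

text \<open>Differentiating \<open>P (1 / x) * exp (- (1 / x))\<close> produces the factor
  \<open>(1 / x)\<^sup>2\<close>, encoded by \<open>monom 1 2\<close>, and replaces \<open>P\<close>
  by \<open>P - P'\<close>. The family is thus closed under differentiation, and one induction over
  all \<open>P\<close> gives smoothness.\<close>

lemma flat_exp_deriv:
  "(flat_exp P has_field_derivative flat_exp (monom 1 2 * (P - pderiv P)) x) (at x)"
proof -
  let ?Q = "monom 1 2 * (P - pderiv P)"
  consider "x > 0" | "x < 0" | "x = 0" by linarith
  then show ?thesis
  proof cases
    case 1
    have "((\<lambda>x. poly P (1 / x) * exp (- (1 / x))) has_field_derivative flat_exp ?Q x) (at x)"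
      using 1 by (auto intro!: derivative_eq_intros
          simp: flat_exp_def poly_monom field_simps power2_eq_square)
    then show ?thesis
      by (rule has_field_derivative_transform_within_open[of _ _ _ "{0<..}"])
        (use 1 in \<open>auto simp: flat_exp_def\<close>)
  next
    case 2
    have "((\<lambda>x. 0) has_field_derivative flat_exp ?Q x) (at x)"
      using 2 by (auto simp: flat_exp_def)
    then show ?thesis
      by (rule has_field_derivative_transform_within_open[of _ _ _ "{..<0}"])
        (use 2 in \<open>auto simp: flat_exp_def\<close>)
  next
    case 3
    \<comment> \<open>Dividing by \<open>h\<close> is one more power of \<open>1 / h\<close>, so the
      difference quotient at 0 is again a member of the family.\<close>
    have "((\<lambda>h. flat_exp (monom 1 1 * P) h) \<longlongrightarrow> 0) (at 0)" by (rule tendsto_flat_exp)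
    then have "((\<lambda>h. (flat_exp P (0 + h) - flat_exp P 0) / h) \<longlongrightarrow> 0) (at 0)"
      by (rule Lim_transform_eventually)
        (auto simp: flat_exp_def poly_monom eventually_at_filter)
    then show ?thesis using 3 by (simp add: DERIV_def flat_exp_def)
  qed
qed

lemma smooth1_flat_exp: "smooth1 (\<lambda>x. of_real (flat_exp P x))"
  unfolding smooth1_def
proof
  fix k show "Ck1 k (\<lambda>x. of_real (flat_exp P x))"
  proof (induction k arbitrary: P)
    case 0
    have "continuous_on UNIV (flat_exp P)"
      using flat_exp_deriv by (meson DERIV_isCont continuous_at_imp_continuous_on)
    then show ?case by (auto intro!: continuous_intros)
  next
    case (Suc k)
    have "((\<lambda>x. complex_of_real (flat_exp P x)) has_vector_derivative
        of_real (flat_exp (monom 1 2 * (P - pderiv P)) x)) (at x)" for x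
      using flat_exp_deriv by (intro has_vector_derivative_of_real)
        (simp add: has_real_derivative_iff_has_vector_derivative)
    moreover have "Ck1 k (\<lambda>x. of_real (flat_exp (monom 1 2 * (P - pderiv P)) x))"
      by (rule Suc)
    ultimately show ?case by (rule Ck1_Suc_intro)
  qed
qed

lemma continuous_antiderivative:
  fixes f :: "real \<Rightarrow> 'a::euclidean_space"
  assumes "continuous_on UNIV f"
  shows "\<exists>F. \<forall>x. (F has_vector_derivative f x) (at x)"
  using einterval_antiderivative[of "-\<infinity>" "\<infinity>" f] assms
  by (auto simp: continuous_on_eq_continuous_at)

text \<open>A normalised primitive of the bump \<open>b\<close>, a product of two flat exponentials
  facing each other, positive exactly between 1 and 2. The transition starts at 1 rather than 0 so
  that \<open>S (n * y)\<close> vanishes on a neighbourhood of \<open>y = 0\<close>; the facts about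
  \<open>S'\<close> serve the gradient bound in \<open>sine_cutoff\<close>.\<close>

lemma smooth_step_exists:
  "\<exists>S S' :: real \<Rightarrow> real. (\<forall>x. (S has_field_derivative S' x) (at x)) \<and>
     smooth1 (\<lambda>x. of_real (S x)) \<and>
     (\<forall>x\<le>1. S x = 0) \<and> (\<forall>x\<ge>2. S x = 1) \<and> (\<forall>x. 0 \<le> S x \<and> S x \<le> 1) \<and>
     (\<exists>M. \<forall>x. \<bar>S' x\<bar> \<le> M) \<and> (\<forall>x. x \<le> 1 \<or> 2 \<le> x \<longrightarrow> S' x = 0)"
proof -
  define b where "b x = flat_exp 1 (x - 1) * flat_exp 1 (2 - x)" for x
  have b0: "b x = 0" if "x \<le> 1 \<or> 2 \<le> x" for x using that by (auto simp: b_def flat_exp_def)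
  have bpos: "b x > 0" if "1 < x" "x < 2" for x using that by (auto simp: b_def flat_exp_def)
  have bnn: "b x \<ge> 0" for x using b0 bpos[of x] by (cases "1 < x \<and> x < 2") auto
  have f01: "0 \<le> flat_exp 1 x" "flat_exp 1 x \<le> 1" for x by (auto simp: flat_exp_def)
  have b1: "\<bar>b x\<bar> \<le> 1" for x using f01 bnn by (auto simp: b_def intro: mult_le_one)
  have "smooth1 (\<lambda>x. of_real (flat_exp 1 (1 * x + (-1))) * of_real (flat_exp 1 ((-1) * x + 2)))"
    by (intro smooth1_mult smooth1_affine[where f="\<lambda>x. of_real (flat_exp 1 x)"] smooth1_flat_exp)
  then have sb: "smooth1 (\<lambda>x. of_real (b x))" by (simp add: b_def)
  then have "continuous_on UNIV (\<lambda>x. Re (of_real (b x)))"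
    by (intro continuous_intros smooth1_continuous)
  then obtain B where B: "\<And>x. (B has_vector_derivative b x) (at x)"
    using continuous_antiderivative by fastforce
  then have Bd: "(B has_field_derivative b x) (at x)" for x
    by (simp add: has_real_derivative_iff_has_vector_derivative)
  have mono: "B x \<le> B y" if "x \<le> y" for x y
    using DERIV_nonneg_imp_nondecreasing[OF that] Bd bnn by blast
  have Blt: "B 1 < B 2"
    by (rule DERIV_pos_imp_increasing_open[of 1 2]) (use Bd bpos in \<open>auto intro: continuous_on_vector_derivative B\<close>)
  have Bl: "B x = B 1" if "x \<le> 1" for x
  proof (cases "x = 1")
    case False
    show ?thesis
      by (rule DERIV_isconst_end[symmetric]) (use Bd b0 that False in \<open>auto intro: continuous_on_vector_derivative B\<close>, metis b0 Bd less_imp_le)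
  qed auto
  have Br: "B x = B 2" if "x \<ge> 2" for x
  proof (cases "x = 2")
    case False
    show ?thesis
      by (rule DERIV_isconst_end) (use Bd b0 that False in \<open>auto intro: continuous_on_vector_derivative B\<close>, metis b0 Bd less_imp_le)
  qed auto
  define c where "c = B 2 - B 1"
  have c: "c > 0" using Blt by (simp add: c_def)
  define S where "S x = (B x - B 1) / c" for x
  have S: "(S has_field_derivative b x / c) (at x)" for x
    unfolding S_def using c by (auto intro!: derivative_eq_intros Bd)
  have "smooth1 (\<lambda>x. of_real (S x))"
  proof (rule smooth1_intro)
    show "((\<lambda>x. of_real (S x)) has_vector_derivative of_real (b x / c)) (at x)" for x
      using S by (intro has_vector_derivative_of_real) (simp add: has_real_derivative_iff_has_vector_derivative)
    show "smooth1 (\<lambda>x. of_real (b x / c))"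
      using smooth1_mult[OF sb smooth1_const[of "of_real (1/c)"]] by simp
  qed
  moreover have "S x = 0" if "x \<le> 1" for x using Bl[OF that] by (simp add: S_def)
  moreover have "S x = 1" if "x \<ge> 2" for x using Br[OF that] c by (simp add: S_def c_def)
  moreover have "0 \<le> S x \<and> S x \<le> 1" for x
  proof -
    have "B 1 \<le> B x" using Bl mono by (metis nle_le)
    moreover have "B x \<le> B 2" using Br mono by (metis nle_le)
    ultimately show ?thesis using c by (simp add: S_def c_def)
  qed
  moreover have "\<bar>b x / c\<bar> \<le> 1 / c" for x using b1[of x] c by (simp add: divide_right_mono)
  ultimately show ?thesis using S b0 by (intro exI[of _ S] exI[of _ "\<lambda>x. b x / c"]) auto
qed

subsection \<open>Test functions and cutoffs\<close>

text \<open>All test functions inserted into the equation are such products, which reduces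
  smoothness, supports and Laplacians to one variable.\<close>

definition tensor :: "(real \<Rightarrow> complex) \<Rightarrow> (real \<Rightarrow> complex) \<Rightarrow> real \<times> real \<Rightarrow> complex" where
  "tensor A B z = A (fst z) * B (snd z)"

lemma dx_tensor:
  assumes "\<And>x. (A has_vector_derivative A' x) (at x)"
  shows "dx (tensor A B) = tensor A' B"
proof
  fix z
  have "((\<lambda>t. tensor A B (t, snd z)) has_vector_derivative tensor A' B z) (at (fst z))"
    unfolding tensor_def using assms[of "fst z"] by (auto intro!: has_vector_derivative_mult_left)
  then show "dx (tensor A B) z = tensor A' B z"
    unfolding dx_def by (rule vector_derivative_at)
qed

lemma dy_tensor:
  assumes "\<And>x. (B has_vector_derivative B' x) (at x)"
  shows "dy (tensor A B) = tensor A B'"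
proof
  fix z
  have "((\<lambda>t. tensor A B (fst z, t)) has_vector_derivative tensor A B' z) (at (snd z))"
    unfolding tensor_def using assms[of "snd z"] by (auto intro!: has_vector_derivative_mult_right)
  then show "dy (tensor A B) z = tensor A B' z"
    unfolding dy_def by (rule vector_derivative_at)
qed

lemma laplacian_tensor:
  assumes "\<And>x. (A has_vector_derivative A' x) (at x)" "\<And>x. (A' has_vector_derivative A'' x) (at x)"
    "\<And>x. (B has_vector_derivative B' x) (at x)" "\<And>x. (B' has_vector_derivative B'' x) (at x)"
  shows "laplacian (tensor A B) z = tensor A'' B z + tensor A B'' z"
  by (simp add: laplacian_def dx_tensor[OF assms(1)] dx_tensor[OF assms(2)]
      dy_tensor[OF assms(3)] dy_tensor[OF assms(4)])

lemma differentiable_tensor: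
  assumes "smooth1 A" "smooth1 B"
  shows "tensor A B differentiable (at z)"
proof -
  obtain A' B' where "(A has_vector_derivative A' (fst z)) (at (fst z))"
    "(B has_vector_derivative B' (snd z)) (at (snd z))"
    using assms by (meson smooth1E)
  then have "((\<lambda>z. A (fst z)) has_derivative (\<lambda>h. fst h *\<^sub>R A' (fst z))) (at z)"
    "((\<lambda>z. B (snd z)) has_derivative (\<lambda>h. snd h *\<^sub>R B' (snd z))) (at z)"
    unfolding has_vector_derivative_def
    by (auto intro!: has_derivative_compose[where f=fst and s=UNIV, simplified]
        has_derivative_compose[where f=snd and s=UNIV, simplified] has_derivative_fst has_derivative_snd has_derivative_ident)
  from has_derivative_mult[OF this] show ?thesis
    by (auto simp: differentiable_def tensor_def[abs_def])
qed

lemma continuous_on_tensor: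
  assumes "continuous_on UNIV A" "continuous_on UNIV B"
  shows "continuous_on S (tensor A B)"
proof -
  have "continuous_on S (\<lambda>z. A (fst z))" "continuous_on S (\<lambda>z. B (snd z))"
    using continuous_on_compose2[OF assms(1), of S fst] continuous_on_compose2[OF assms(2), of S snd]
    by (simp_all add: continuous_on_fst continuous_on_snd continuous_on_id)
  then show ?thesis unfolding tensor_def[abs_def] by (rule continuous_on_mult)
qed

lemma Ck_tensor: "smooth1 A \<Longrightarrow> smooth1 B \<Longrightarrow> Ck k (tensor A B)"
proof (induction k arbitrary: A B)
  case 0
  then show ?case by (simp add: continuous_on_tensor smooth1_continuous)
next
  case (Suc k)
  obtain A' where A': "\<And>x. (A has_vector_derivative A' x) (at x)" "smooth1 A'"
    using Suc.prems smooth1E by metis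
  obtain B' where B': "\<And>x. (B has_vector_derivative B' x) (at x)" "smooth1 B'"
    using Suc.prems smooth1E by metis
  show ?case
    using Suc.IH Suc.prems A'(2) B'(2)
    by (simp add: dx_tensor[OF A'(1)] dy_tensor[OF B'(1)] differentiable_tensor)
qed

lemma tensor_test_function:
  assumes "smooth1 A" "smooth1 B"
    and A: "\<And>x. x \<notin> {l..r} \<Longrightarrow> A x = 0" and B: "\<And>y. y \<notin> {c..d} \<Longrightarrow> B y = 0"
    and sub: "{l..r} \<times> {c..d} \<subseteq> \<Omega>"
  shows "tensor A B \<in> test_functions \<Omega>"
proof -
  have "{z. tensor A B z \<noteq> 0} \<subseteq> {l..r} \<times> {c..d}"
    using A B by (force simp: tensor_def)
  moreover have "closed ({l..r} \<times> {c..d})" "bounded ({l..r} \<times> {c..d})"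
    by (auto intro: closed_Times bounded_Times)
  ultimately have "closure {z. tensor A B z \<noteq> 0} \<subseteq> {l..r} \<times> {c..d}"
    "bounded {z. tensor A B z \<noteq> 0}"
    using closure_minimal bounded_subset by blast+
  with sub show ?thesis
    unfolding test_functions_def using Ck_tensor[OF assms(1,2)] by (auto simp: compact_closure)
qed

lemma vector_derivative_locally_constant:
  assumes "(f has_vector_derivative D) (at x)" "open U" "x \<in> U" "\<And>y. y \<in> U \<Longrightarrow> f y = c"
  shows "D = 0"
proof -
  have "(f has_vector_derivative 0) (at x)"
    by (rule has_vector_derivative_transform_within_open[of "\<lambda>x. c" _ _ U])
      (use assms in auto)
  then show ?thesis using assms(1) vector_derivative_unique_at by blast
qed

lemma
  assumes "\<phi> \<in> test_functions \<Omega>"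
  shows test_function_continuous: "continuous_on S \<phi>"
    and test_function_continuous_dy: "continuous_on S (dy \<phi>)"
    and test_function_deriv_y: "((\<lambda>t. \<phi> (x, t)) has_vector_derivative dy \<phi> (x, y)) (at y)"
    and test_function_outside: "z \<notin> \<Omega> \<Longrightarrow> \<phi> z = 0"
    and test_function_compact: "compact (closure {z. \<phi> z \<noteq> 0})" "closure {z. \<phi> z \<noteq> 0} \<subseteq> \<Omega>"
    and test_function_dy_outside: "z \<notin> \<Omega> \<Longrightarrow> dy \<phi> z = 0"
proof -
  have C: "Ck k \<phi>" for k using assms by (auto simp: test_functions_def)
  show "continuous_on S \<phi>" using C[of 0] by (auto intro: continuous_on_subset)
  show "continuous_on S (dy \<phi>)" using C[of 1] by (auto intro: continuous_on_subset)
  show deriv: "((\<lambda>t. \<phi> (x, t)) has_vector_derivative dy \<phi> (x, y)) (at y)" for x y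
  proof -
    have "\<phi> differentiable (at (x, y))" using C[of 1] by auto
    then obtain D where D: "(\<phi> has_derivative D) (at (x, y))" by (auto simp: differentiable_def)
    have "((\<lambda>t. (x, t)) has_derivative (\<lambda>h. (0, h))) (at y)"
      by (auto intro!: derivative_eq_intros)
    then have "((\<lambda>t. \<phi> (x, t)) has_derivative (\<lambda>h. D (0, h))) (at y)"
      using D by (rule has_derivative_compose)
    then have "(\<lambda>t. \<phi> (x, t)) differentiable (at y)" by (auto simp: differentiable_def)
    then show ?thesis by (simp add: dy_def vector_derivative_works)
  qed
  show *: "compact (closure {z. \<phi> z \<noteq> 0})" "closure {z. \<phi> z \<noteq> 0} \<subseteq> \<Omega>"
    using assms by (auto simp: test_functions_def)
  show "\<phi> z = 0" if "z \<notin> \<Omega>"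
    using * that closure_subset[of "{z. \<phi> z \<noteq> 0}"] by auto
  show "dy \<phi> z = 0" if "z \<notin> \<Omega>"
  proof -
    \<comment> \<open>Vanishing of \<open>\<phi>\<close> at \<open>z\<close> alone says nothing
      about its derivative. The support is closed, so on the vertical line through \<open>z\<close>
      its complement is an open set containing \<open>snd z\<close>.\<close>
    let ?U = "(\<lambda>t. (fst z, t)) -` (- closure {z. \<phi> z \<noteq> 0})"
    have "open ?U" by (intro open_vimage continuous_intros) auto
    moreover have "snd z \<in> ?U" using that * by auto
    moreover have "\<phi> (fst z, t) = 0" if "t \<in> ?U" for t
      using that closure_subset[of "{z. \<phi> z \<noteq> 0}"] by auto
    ultimately show ?thesis
      using vector_derivative_locally_constant[OF deriv[of "fst z" "snd z"], of ?U 0] by simp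
  qed
qed

text \<open>The plateau is an open set \<open>U\<close> around the closed interval, so that the
  derivatives of \<eta> vanish on all of \<open>{\<alpha>..\<beta>}\<close>, end points included.
  The support keeps a distance from 0 and \<open>L\<close>, which makes products with \<eta>
  compactly supported in the \<open>x\<close> direction.\<close>

lemma plateau_exists:
  assumes "0 < \<alpha>" "\<alpha> < \<beta>" "\<beta> < (L::real)"
  obtains \<eta> :: "real \<Rightarrow> real" and l r U where "smooth1 (\<lambda>x. of_real (\<eta> x))" "0 < l" "l < r" "r < L"
    "\<And>x. x \<notin> {l..r} \<Longrightarrow> \<eta> x = 0" "open U" "{\<alpha>..\<beta>} \<subseteq> U" "\<And>x. x \<in> U \<Longrightarrow> \<eta> x = 1"
    "\<And>x. 0 \<le> \<eta> x" "\<And>x. \<eta> x \<le> 1"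
proof -
  obtain S :: "real \<Rightarrow> real" where S: "smooth1 (\<lambda>x. of_real (S x))" "\<And>x. x \<le> 1 \<Longrightarrow> S x = 0"
    "\<And>x. 2 \<le> x \<Longrightarrow> S x = 1" "\<And>x. 0 \<le> S x" "\<And>x. S x \<le> 1"
    using smooth_step_exists by metis
  \<comment> \<open>With these slopes \<open>p * x\<close> passes 1 and 2 at
    \<open>\<alpha> / 3\<close> and \<open>2 * \<alpha> / 3\<close>; \<open>q * (L - x)\<close> does
    so at the mirrored thirds of \<open>{\<beta>..L}\<close>.\<close>
  define p q where "p = 3 / \<alpha>" and "q = 3 / (L - \<beta>)"
  have pq: "p > 0" "q > 0" using assms by (auto simp: p_def q_def)
  define \<eta> where "\<eta> x = S (p * x + 0) * S (- q * x + q * L)" for x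
  have v: "- q * x + q * L = 3 * (L - x) / (L - \<beta>)" for x
    by (simp add: q_def right_diff_distrib diff_divide_distrib)
  show ?thesis
  proof (rule that[of \<eta> "\<alpha> / 3" "L - (L - \<beta>) / 3" "{2 * \<alpha> / 3 <..< L - 2 * (L - \<beta>) / 3}"])
    show "smooth1 (\<lambda>x. of_real (\<eta> x))"
      unfolding \<eta>_def of_real_mult
      by (intro smooth1_mult smooth1_affine[where f="\<lambda>x. of_real (S x)"] S)
    show "\<eta> x = 0" if "x \<notin> {\<alpha> / 3..L - (L - \<beta>) / 3}" for x
    proof -
      have "p * x + 0 \<le> 1 \<or> - q * x + q * L \<le> 1"
        using that assms unfolding v by (auto simp: p_def field_simps)
      then show ?thesis using S(2) by (auto simp: \<eta>_def)
    qed
    show "\<eta> x = 1" if "x \<in> {2 * \<alpha> / 3 <..< L - 2 * (L - \<beta>) / 3}" for x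
    proof -
      have "p * x + 0 \<ge> 2" "- q * x + q * L \<ge> 2"
        using that assms unfolding v by (auto simp: p_def field_simps)
      then show ?thesis using S(3) by (auto simp: \<eta>_def)
    qed
    show "0 \<le> \<eta> x" "\<eta> x \<le> 1" for x
      using S(4,5) by (auto simp: \<eta>_def intro: mult_le_one)
  qed (use assms in \<open>auto simp: field_simps\<close>)
qed

text \<open>
  The cutoff has slope of order \<open>n j\<close> on a layer of width of order \<open>1 / n j\<close> at each end, where the
  sine is of order \<open>1 / n j\<close>; hence the uniform bound on \<open>T' j\<close>.
\<close>

lemma sine_cutoff:
  assumes "a > 0" "sin (\<kappa> * a) = 0" "\<kappa> > 0"
  obtains T T' :: "nat \<Rightarrow> real \<Rightarrow> real" and \<delta> :: "nat \<Rightarrow> real" and C where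
    "\<And>j. smooth1 (\<lambda>y. of_real (T j y))"
    "\<And>j y. (T j has_field_derivative T' j y) (at y)"
    "\<And>j. 0 < \<delta> j" "\<And>j y. y \<notin> {\<delta> j..a - \<delta> j} \<Longrightarrow> T j y = 0"
    "\<And>j y. \<bar>T j y\<bar> \<le> 1" "\<And>j y. \<bar>T' j y\<bar> \<le> C"
    "\<And>y. y \<in> {0<..<a} \<Longrightarrow> (\<lambda>j. T j y) \<longlonglongrightarrow> sin (\<kappa> * y)"
    "\<And>y. y \<in> {0<..<a} \<Longrightarrow> (\<lambda>j. T' j y) \<longlonglongrightarrow> \<kappa> * cos (\<kappa> * y)"
proof -
  obtain S S' :: "real \<Rightarrow> real" and M where S: "\<And>x. (S has_field_derivative S' x) (at x)"
    "smooth1 (\<lambda>x. of_real (S x))" "\<And>x. x \<le> 1 \<Longrightarrow> S x = 0"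
    "\<And>x. 2 \<le> x \<Longrightarrow> S x = 1" "\<And>x. 0 \<le> S x" "\<And>x. S x \<le> 1" "\<And>x. \<bar>S' x\<bar> \<le> M"
    "\<And>x. x \<le> 1 \<or> 2 \<le> x \<Longrightarrow> S' x = 0"
    using smooth_step_exists by metis
  have M: "M \<ge> 0" using S(7)[of 0] by linarith
  define n where "n j = real (Suc j)" for j
  have n: "n j > 0" for j by (simp add: n_def)
  define u v where "u j y = n j * y + 0" and "v j y = - n j * y + n j * a" for j y
  define T where "T j y = S (u j y) * S (v j y) * sin (\<kappa> * y)" for j y
  define T' where "T' j y = n j * S' (u j y) * sin (\<kappa> * y) * S (v j y)
      - n j * S' (v j y) * sin (\<kappa> * y) * S (u j y) + S (u j y) * S (v j y) * (\<kappa> * cos (\<kappa> * y))" for j y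
  have sin1: "\<bar>sin (\<kappa> * y)\<bar> \<le> \<kappa> * \<bar>y\<bar>" for y
    using abs_sin_x_le_abs_x[of "\<kappa> * y"] \<open>\<kappa> > 0\<close> by (simp add: abs_mult)
  \<comment> \<open>Reflection at the upper side: \<open>sin (\<kappa> * a) = 0\<close> forces
    \<open>cos (\<kappa> * a)\<close> to be 1 or -1, so
    \<open>\<bar>sin (\<kappa> * y)\<bar>\<close> is unchanged when \<open>y\<close> is replaced by
    \<open>a - y\<close>.\<close>
  have sin2: "\<bar>sin (\<kappa> * y)\<bar> \<le> \<kappa> * \<bar>a - y\<bar>" for y
  proof -
    have "\<bar>cos (\<kappa> * a)\<bar> = 1" using assms(2) by (simp add: sin_zero_abs_cos_one)
    moreover have "sin (\<kappa> * (a - y)) = - cos (\<kappa> * a) * sin (\<kappa> * y)"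
      by (simp add: right_diff_distrib sin_diff assms(2))
    ultimately have "\<bar>sin (\<kappa> * y)\<bar> = \<bar>sin (\<kappa> * (a - y))\<bar>" by (simp add: abs_mult)
    then show ?thesis using sin1 by simp
  qed
  \<comment> \<open>\<open>t\<close> is the signed distance to a side. Where \<open>S' w\<close> is
    nonzero, \<open>w < 2\<close>, so the large factor \<open>n j\<close> is consumed by
    \<open>n j * t = w\<close>.\<close>
  have bd: "\<bar>n j * S' w * sin (\<kappa> * y)\<bar> \<le> 2 * M * \<kappa>"
    if "\<bar>sin (\<kappa> * y)\<bar> \<le> \<kappa> * \<bar>t\<bar>" "w = n j * t" for j w y t
  proof (cases "w \<le> 1 \<or> 2 \<le> w")
    case True
    then show ?thesis using S(8) M \<open>\<kappa> > 0\<close> by simp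
  next
    case False
    then have w: "0 < w" "w < 2" by auto
    have "\<bar>n j * S' w * sin (\<kappa> * y)\<bar> = n j * \<bar>S' w\<bar> * \<bar>sin (\<kappa> * y)\<bar>"
      using n[of j] by (simp add: abs_mult)
    also have "\<dots> \<le> n j * M * (\<kappa> * \<bar>t\<bar>)"
      using that S(7) n[of j] M by (intro mult_mono) auto
    also have "\<dots> = M * \<kappa> * \<bar>w\<bar>" using that n[of j] by (simp add: abs_mult)
    also have "\<dots> \<le> M * \<kappa> * 2" using w M \<open>\<kappa> > 0\<close> by (intro mult_left_mono) auto
    finally show ?thesis by simp
  qed
  have lim: "\<forall>\<^sub>F j in sequentially. 2 < n j * t" if "t > 0" for t
  proof -
    have "filterlim (\<lambda>j. t * n j) at_top sequentially"
      unfolding n_def using that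
      by (intro filterlim_tendsto_pos_mult_at_top[OF tendsto_const])
        (use filterlim_compose[OF filterlim_real_sequentially filterlim_Suc] in \<open>simp_all del: of_nat_Suc\<close>)
    then show ?thesis by (auto simp: filterlim_at_top_dense mult.commute)
  qed
  show ?thesis
  \<comment> \<open>Each of the two layers contributes \<open>2 * M * \<kappa>\<close> to the bound,
    and the derivative of the sine contributes \<open>\<kappa>\<close>.\<close>
  proof (rule that[of T T' "\<lambda>j. 1 / n j" "4 * M * \<kappa> + \<kappa>"])
    fix j
    show "smooth1 (\<lambda>y. of_real (T j y))"
      unfolding T_def of_real_mult u_def v_def
      by (intro smooth1_mult smooth1_affine[where f="\<lambda>x. of_real (S x)"] S smooth1_sin)
    show "(T j has_field_derivative T' j y) (at y)" for y
    proof -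
      have "((\<lambda>y. S (u j y)) has_field_derivative S' (u j y) * n j) (at y)"
        "((\<lambda>y. S (v j y)) has_field_derivative S' (v j y) * (- n j)) (at y)"
        unfolding u_def v_def
        by (rule DERIV_chain2[OF S(1)], rule DERIV_cong, (rule derivative_intros)+, simp)+
      then show ?thesis
        unfolding T_def[abs_def] T'_def by (auto intro!: derivative_eq_intros simp: algebra_simps)
    qed
    show "0 < 1 / n j" using n by simp
    show "T j y = 0" if "y \<notin> {1 / n j..a - 1 / n j}" for y
    proof -
      have "u j y \<le> 1 \<or> v j y \<le> 1"
        using that n[of j] by (auto simp: u_def v_def field_simps)
      then show ?thesis using S(3) by (auto simp: T_def)
    qed
    have S1: "\<bar>S x\<bar> \<le> 1" for x using S(5,6)[of x] by simp
    have prod1: "\<bar>x * y\<bar> \<le> c" if "\<bar>x\<bar> \<le> c" "\<bar>y\<bar> \<le> 1" for x y c :: real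
      using mult_mono[OF that] that by (simp add: abs_mult)
    show "\<bar>T j y\<bar> \<le> 1" for y
      unfolding T_def by (intro prod1 S1) auto
    show "\<bar>T' j y\<bar> \<le> 4 * M * \<kappa> + \<kappa>" for y
    proof -
      have "\<bar>n j * S' (u j y) * sin (\<kappa> * y) * S (v j y)\<bar> \<le> 2 * M * \<kappa>"
        by (rule prod1[OF bd[of y y] S1]) (use sin1 in \<open>auto simp: u_def\<close>)
      moreover have "\<bar>n j * S' (v j y) * sin (\<kappa> * y) * S (u j y)\<bar> \<le> 2 * M * \<kappa>"
        by (rule prod1[OF bd[of y "a - y"] S1]) (rule sin2, simp add: v_def right_diff_distrib)
      moreover have "\<bar>\<kappa> * cos (\<kappa> * y) * (S (u j y) * S (v j y))\<bar> \<le> \<kappa>"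
        using \<open>\<kappa> > 0\<close> by (intro prod1 S1) (auto simp: abs_mult)
      ultimately show ?thesis unfolding T'_def by (simp add: mult.commute)
    qed
  next
    fix y assume y: "y \<in> {0<..<a}"
    have ev: "\<forall>\<^sub>F j in sequentially. 2 < u j y \<and> 2 < v j y"
      using lim[of y] lim[of "a - y"] y
      by (auto simp: u_def v_def algebra_simps elim: eventually_elim2)
    show "(\<lambda>j. T j y) \<longlonglongrightarrow> sin (\<kappa> * y)"
      \<comment> \<open>For a fixed interior \<open>y\<close> both cutoffs are eventually 1, so the
        sequence is eventually constant.\<close>
      by (rule tendsto_eventually) (rule eventually_mono[OF ev], auto simp: T_def S(4))
    show "(\<lambda>j. T' j y) \<longlonglongrightarrow> \<kappa> * cos (\<kappa> * y)"
      by (rule tendsto_eventually) (rule eventually_mono[OF ev], auto simp: T'_def S(4,8))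
  qed
qed

subsection \<open>The one-dimensional Helmholtz equation\<close>

text \<open>Cauchy-Schwarz against the constant 1, read off from the nonnegative integral of
  \<open>(h x - I)\<^sup>2\<close>, where \<open>I\<close> is the mean of \<open>h\<close>.\<close>

lemma square_integral_le:
  fixes h :: "real \<Rightarrow> real"
  assumes "continuous_on {0..L} h" "L > 0"
  shows "(integral {0..L} h)\<^sup>2 \<le> L * integral {0..L} (\<lambda>x. (h x)\<^sup>2)"
proof -
  define I where "I = integral {0..L} h / L"
  have i: "h integrable_on {0..L}" "(\<lambda>x. (h x)\<^sup>2) integrable_on {0..L}"
    using assms by (auto intro!: integrable_continuous_interval continuous_intros)
  have "0 \<le> integral {0..L} (\<lambda>x. (h x)\<^sup>2 - 2 * I * h x + I\<^sup>2)"
  proof (rule integral_nonneg)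
    show "0 \<le> (h x)\<^sup>2 - 2 * I * h x + I\<^sup>2" for x
      using zero_le_power2[of "h x - I"] by (simp add: power2_diff algebra_simps)
  qed (use assms in \<open>auto intro!: integrable_continuous_interval continuous_intros\<close>)
  also have "\<dots> = integral {0..L} (\<lambda>x. (h x)\<^sup>2) - 2 * I * integral {0..L} h + I\<^sup>2 * L"
    using i assms(2)
    by (subst integral_add integral_diff; auto intro!: integrable_diff integrable_on_mult_right)+
  also have "\<dots> = integral {0..L} (\<lambda>x. (h x)\<^sup>2) - (integral {0..L} h)\<^sup>2 / L"
    using assms(2) by (simp add: I_def power2_eq_square field_simps)
  finally show ?thesis using assms(2) by (simp add: field_simps)
qed

text \<open>In the applications \<open>b\<close> is the value of \<open>Re c * t\<close> at one end
  of the interval, and \<open>exp b\<close> then cancels exactly against the prefactor of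
  \<open>w\<close> or \<open>z\<close>, so that no growth in \<open>c\<close> survives.\<close>

lemma exp_weighted_increment:
  assumes E: "\<And>x. (E has_vector_derivative exp (c * of_real x) * g x) (at x)"
    and g: "continuous_on UNIV g" and "x \<le> y" "0 \<le> x" "y \<le> L"
    and le: "\<And>t. x \<le> t \<Longrightarrow> t \<le> y \<Longrightarrow> Re c * t \<le> b"
  shows "norm (E y - E x) \<le> exp b * integral {0..L} (\<lambda>t. norm (g t))"
proof -
  have g': "continuous_on S g" for S using g continuous_on_subset by blast
  have "((\<lambda>t. exp (c * of_real t) * g t) has_integral (E y - E x)) {x..y}"
    by (rule fundamental_theorem_of_calculus[OF \<open>x \<le> y\<close>], rule has_vector_derivative_at_within, rule E)
  then have "norm (E y - E x) = norm (integral {x..y} (\<lambda>t. exp (c * of_real t) * g t))"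
    by (simp add: integral_unique)
  also have "\<dots> \<le> integral {x..y} (\<lambda>t. exp b * norm (g t))"
  proof (intro integral_norm_bound_integral)
    show "norm (exp (c * of_real t) * g t) \<le> exp b * norm (g t)" if "t \<in> {x..y}" for t
      using le[of t] that by (auto simp: norm_mult intro!: mult_right_mono)
  qed (auto intro!: integrable_continuous_interval continuous_intros g')
  also have "\<dots> \<le> integral {0..L} (\<lambda>t. exp b * norm (g t))"
    by (intro integral_subset_le) (use assms in \<open>auto intro!: integrable_continuous_interval continuous_intros g'\<close>)
  finally show ?thesis by simp
qed

lemma smooth1_exp_mult: "smooth1 g \<Longrightarrow> smooth1 (\<lambda>x. exp (c * of_real x) * g x)"
  by (intro smooth1_mult smooth1_exp)

lemma vector_derivative_zero_imp_const:
  fixes D :: "real \<Rightarrow> 'a::real_normed_vector"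
  assumes "\<And>x. (D has_vector_derivative 0) (at x)"
  shows "D x = D 0"
  by (rule has_derivative_zero_unique[of UNIV D x 0, simplified])
    (use assms in \<open>auto simp: has_vector_derivative_def\<close>)

text \<open>
  Write \<open>\<mu> = -m\<^sup>2\<close> with \<open>Re m \<ge> 0\<close>. The first-order equations \<open>w' = m w - g\<close>, solved backwards
  from \<open>w L = 0\<close>, and \<open>z' = -m z + g\<close>, solved forwards from \<open>z 0 = 0\<close>, have solutions bounded by
  \<open>\<integral>|g|\<close> for all such \<open>m\<close>, and \<open>(w + z) / (2 m)\<close> solves the second-order equation.
  Subtracting \<open>w 0 exp (-m x) / (2 m)\<close> normalises it to vanish at 0, which removes the
  singularity at \<open>m = 0\<close>: \<open>\<psi>\<close> is recovered by integrating its bounded derivative \<open>q\<close>.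
\<close>

lemma helmholtz_1d_solution:
  fixes \<mu> L :: real
  assumes g: "smooth1 g" and L: "L > 0"
  obtains \<psi> \<psi>' where "\<And>x. (\<psi> has_vector_derivative \<psi>' x) (at x)"
    "\<And>x. (\<psi>' has_vector_derivative - of_real \<mu> * \<psi> x - g x) (at x)" "smooth1 \<psi>"
    "\<And>x. x \<in> {0..L} \<Longrightarrow> norm (\<psi>' x) \<le> 3 / 2 * integral {0..L} (\<lambda>t. norm (g t))"
    "\<And>x. x \<in> {0..L} \<Longrightarrow> norm (\<psi> x) \<le> L * (3 / 2 * integral {0..L} (\<lambda>t. norm (g t)))"
proof -
  define m where "m = csqrt (- of_real \<mu>)"
  have m2: "m * m = - of_real \<mu>" unfolding m_def by (metis power2_csqrt power2_eq_square)
  have Rm: "Re m \<ge> 0" unfolding m_def by (rule Re_csqrt)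
  let ?e = "\<lambda>c x. exp (c * complex_of_real x)"
  let ?I = "integral {0..L} (\<lambda>t. norm (g t))"
  have gc: "continuous_on S g" for S using g by (rule smooth1_continuous)
  obtain E1 where E1: "\<And>x. (E1 has_vector_derivative ?e (- m) x * g x) (at x)"
    using continuous_antiderivative[of "\<lambda>x. ?e (- m) x * g x"] smooth1_exp_mult[OF g, of "- m"] smooth1_continuous by blast
  obtain E2 where E2: "\<And>x. (E2 has_vector_derivative ?e m x * g x) (at x)"
    using continuous_antiderivative[of "\<lambda>x. ?e m x * g x"] smooth1_exp_mult[OF g, of m] smooth1_continuous by blast
  \<comment> \<open>Variation of constants. The base points \<open>L\<close> for \<open>w\<close>
    and 0 for \<open>z\<close> are chosen so that the exponential weight never exceeds 1 in modulus
    under the integral, thanks to \<open>Re m \<ge> 0\<close>.\<close>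
  define w where "w x = ?e m x * (E1 L - E1 x)" for x
  define z where "z x = ?e (- m) x * (E2 x - E2 0)" for x
  have ee: "?e m x * ?e (- m) x = 1" for x by (simp flip: exp_add)
  have w': "(w has_vector_derivative m * w x + - g x) (at x)" for x
  proof -
    have "(w has_vector_derivative ?e m x * (- (?e (- m) x * g x)) + m * ?e m x * (E1 L - E1 x)) (at x)"
      unfolding w_def[abs_def]
      by (rule has_vector_derivative_mult[OF has_vector_derivative_exp_of_real])
        (auto intro!: derivative_eq_intros E1)
    then show ?thesis using ee[of x] by (simp add: w_def mult.assoc[symmetric])
  qed
  have z': "(z has_vector_derivative - m * z x + g x) (at x)" for x
  proof -
    have "(z has_vector_derivative ?e (- m) x * (?e m x * g x) + - m * ?e (- m) x * (E2 x - E2 0)) (at x)"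
      unfolding z_def[abs_def]
      by (rule has_vector_derivative_mult[OF has_vector_derivative_exp_of_real])
        (auto intro!: derivative_eq_intros E2)
    moreover have "?e (- m) x * (?e m x * g x) = g x"
      using ee[of x] by (metis mult.assoc mult.commute mult_1)
    ultimately have "(z has_vector_derivative g x + - m * ?e (- m) x * (E2 x - E2 0)) (at x)"
      by (simp only:)
    then show ?thesis by (simp only: z_def mult.assoc add.commute)
  qed
  have wb: "norm (w x) \<le> ?I" if "x \<in> {0..L}" for x
  proof -
    have "norm (E1 L - E1 x) \<le> exp (- Re m * x) * ?I"
      by (rule exp_weighted_increment[OF E1 gc]) (use that Rm in \<open>auto intro: mult_left_mono\<close>)
    then have "norm (w x) \<le> exp (Re m * x) * (exp (- Re m * x) * ?I)"
      by (simp add: w_def norm_mult)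
    then show ?thesis by (simp flip: mult.assoc exp_add)
  qed
  have zb: "norm (z x) \<le> ?I" if "x \<in> {0..L}" for x
  proof -
    have "norm (E2 x - E2 0) \<le> exp (Re m * x) * ?I"
      by (rule exp_weighted_increment[OF E2 gc]) (use that Rm in \<open>auto intro: mult_left_mono\<close>)
    then have "norm (z x) \<le> exp (- (Re m * x)) * (exp (Re m * x) * ?I)"
      by (simp add: z_def norm_mult)
    then show ?thesis by (simp flip: mult.assoc exp_add)
  qed
  have I0: "?I \<ge> 0" using order_trans[OF norm_ge_zero wb[of 0]] L by simp
  \<comment> \<open>Differentiating \<open>(w x + z x - w 0 * exp (- m * x)) / (2 * m)\<close> gives
    exactly this: the \<open>g\<close> terms and the factor \<open>m\<close> cancel, so the formula
    still makes sense for \<open>m = 0\<close>.\<close>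
  define q where "q x = (w x - z x + w 0 * ?e (- m) x) * (1 / 2)" for x
  have sw: "smooth1 w" by (rule smooth1_linear_ode[OF w'])
      (use smooth1_mult[OF smooth1_const[of "-1"] g] in simp)
  have sz: "smooth1 z" by (rule smooth1_linear_ode[OF z' g])
  have "smooth1 (\<lambda>x. (w x + (- 1) * z x + w 0 * ?e (- m) x) * (1 / 2))"
    by (intro smooth1_mult smooth1_add smooth1_const sw sz smooth1_exp)
  then have sq: "smooth1 q" by (simp add: q_def[abs_def])
  obtain P where P: "\<And>x. (P has_vector_derivative q x) (at x)"
    using continuous_antiderivative[OF smooth1_continuous[OF sq]] by blast
  define \<psi> where "\<psi> x = P x - P 0" for x
  have \<psi>: "(\<psi> has_vector_derivative q x) (at x)" for x
    unfolding \<psi>_def[abs_def] by (auto intro!: derivative_eq_intros P)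
  \<comment> \<open>The expected identity for \<open>\<psi>\<close> is multiplied by
    \<open>2 * m\<close> to avoid a division. \<open>D\<close> has derivative 0, and
    \<open>D 0 = 0\<close> because \<open>\<psi> 0 = 0\<close> and \<open>z 0 = 0\<close>.\<close>
  define D where "D x = 2 * m * \<psi> x - (w x + z x - w 0 * ?e (- m) x)" for x
  have "(D has_vector_derivative 2 * m * q x
      - ((m * w x + - g x) + (- m * z x + g x) - w 0 * (- m * ?e (- m) x))) (at x)" for x
    unfolding D_def[abs_def]
    by (intro has_vector_derivative_diff has_vector_derivative_add has_vector_derivative_mult_right
        \<psi> w' z' has_vector_derivative_exp_of_real)
  moreover have "2 * m * q x
      - ((m * w x + - g x) + (- m * z x + g x) - w 0 * (- m * ?e (- m) x)) = 0" for x
    by (simp add: q_def algebra_simps)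
  ultimately have "(D has_vector_derivative 0) (at x)" for x by metis
  then have D: "D x = 0" for x
    using vector_derivative_zero_imp_const[of D x] by (simp add: D_def \<psi>_def z_def)
  have q': "(q has_vector_derivative - of_real \<mu> * \<psi> x - g x) (at x)" for x
  proof -
    have "(q has_vector_derivative ((m * w x + - g x) - (- m * z x + g x) + w 0 * (- m * ?e (- m) x)) * (1 / 2)) (at x)"
      unfolding q_def[abs_def]
      by (intro has_vector_derivative_diff has_vector_derivative_add has_vector_derivative_mult_right
          has_vector_derivative_mult_left w' z' has_vector_derivative_exp_of_real)
    moreover have "((m * w x + - g x) - (- m * z x + g x) + w 0 * (- m * ?e (- m) x)) * (1 / 2)
        = - of_real \<mu> * \<psi> x - g x"
    proof -
      have "w x + z x - w 0 * ?e (- m) x = 2 * m * \<psi> x" using D[of x] by (simp add: D_def)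
      then have "m * (w x + z x - w 0 * ?e (- m) x) * (1 / 2) = (m * m) * \<psi> x"
        by (simp only:) (simp add: mult.assoc)
      then show ?thesis unfolding m2 by (simp add: algebra_simps)
    qed
    ultimately show ?thesis by (simp only:)
  qed
  \<comment> \<open>The factor 3/2 is half of three terms, \<open>w x\<close>, \<open>z x\<close>
    and \<open>w 0 * exp (- m * x)\<close>, each bounded by \<open>?I\<close>.\<close>
  have qb: "norm (q x) \<le> 3 / 2 * ?I" if x: "x \<in> {0..L}" for x
  proof -
    have "norm (?e (- m) x) \<le> 1" using x Rm by simp
    then have "norm (w 0 * ?e (- m) x) \<le> ?I * 1"
      unfolding norm_mult using wb[of 0] L I0 by (intro mult_mono) auto
    moreover have "norm (w x - z x) \<le> norm (w x) + norm (z x)" by (rule norm_triangle_ineq4)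
    moreover have "norm (q x) \<le> (norm (w x - z x) + norm (w 0 * ?e (- m) x)) * (1 / 2)"
    proof -
      have "norm (q x) = norm (w x - z x + w 0 * ?e (- m) x) * (1 / 2)"
        unfolding q_def norm_mult[of _ "1 / 2"] by (simp add: norm_divide)
      then show ?thesis using norm_triangle_ineq[of "w x - z x" "w 0 * ?e (- m) x"] by simp
    qed
    ultimately show ?thesis using wb[OF x] zb[OF x] by simp
  qed
  have \<psi>b: "norm (\<psi> x) \<le> L * (3 / 2 * ?I)" if x: "x \<in> {0..L}" for x
  proof -
    have "(q has_integral \<psi> x - \<psi> 0) {0..x}"
      using x \<psi> by (intro fundamental_theorem_of_calculus) (auto intro: has_vector_derivative_at_within)
    then have "norm (\<psi> x - \<psi> 0) \<le> (3 / 2 * ?I) * measure lborel {0..x}"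
      by (rule has_integral_bound_real[rotated 2, where S="{}"])
        (use x qb L I0 in auto)
    also have "\<dots> = (3 / 2 * ?I) * x" using x by simp
    also have "\<dots> \<le> (3 / 2 * ?I) * L"
      using x I0 by (intro mult_left_mono) auto
    finally show ?thesis by (simp add: \<psi>_def mult.commute)
  qed
  show ?thesis using that[OF \<psi> q' smooth1_intro[OF \<psi> sq] qb \<psi>b] by blast
qed

subsection \<open>Sine modes\<close>

text \<open>For \<open>k \<ge> 1\<close> these are the Dirichlet eigenfunctions of the interval
  \<open>{0..a}\<close>. Index 0 gives the zero function, which makes lowering the index from 1
  harmless.\<close>

definition mode :: "real \<Rightarrow> nat \<Rightarrow> real \<Rightarrow> real" where
  "mode a k y = sin (real k * pi / a * y)"

lemma has_integral_cos_zero: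
  assumes "a > 0" "n \<noteq> (0::int)"
  shows "((\<lambda>y. cos (of_int n * pi / a * y)) has_integral 0) {0..a}"
proof -
  let ?c = "of_int n * pi / a"
  have c: "?c \<noteq> 0" using assms by simp
  have "((\<lambda>y. cos (?c * y)) has_integral (sin (?c * a) / ?c - sin (?c * 0) / ?c)) {0..a}"
    by (intro fundamental_theorem_of_calculus)
      (use assms c in \<open>auto intro!: derivative_eq_intros simp flip: has_real_derivative_iff_has_vector_derivative\<close>)
  then show ?thesis using assms by (simp add: mult.commute sin_npi_int[simplified mult.commute] )
qed

text \<open>The product-to-sum formula leaves cosines with indices \<open>j - k\<close> and
  \<open>j + k\<close>, taken as integers because the difference may be negative.\<close>

lemma mode_orthogonal:
  assumes "a > 0" "j \<ge> 1" "k \<ge> 1"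
  shows "((\<lambda>y. mode a j y * mode a k y) has_integral (if j = k then a / 2 else 0)) {0..a}"
proof -
  let ?c = "\<lambda>n::int. \<lambda>y. cos (of_int n * pi / a * y)"
  have "mode a j y * mode a k y = (?c (int j - int k) y - ?c (int j + int k) y) * (1 / 2)" for y
    by (simp add: mode_def sin_times_sin diff_divide_distrib add_divide_distrib algebra_simps)
  moreover have "(?c (int j - int k) has_integral (if j = k then a else 0)) {0..a}"
    using has_integral_cos_zero[OF assms(1), of "int j - int k"] has_integral_const_real[of "1::real" 0 a] assms
    by (auto simp: of_nat_eq_iff)
  moreover have "(?c (int j + int k) has_integral 0) {0..a}"
    using assms by (intro has_integral_cos_zero) auto
  ultimately have "((\<lambda>y. mode a j y * mode a k y) has_integral ((if j = k then a else 0) - 0) * (1 / 2)) {0..a}"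
    by (simp only:) (intro has_integral_mult_left has_integral_diff)
  then show ?thesis by (cases "j = k") simp_all
qed

lemma mode_parseval_1d:
  assumes "a > 0" "finite I" "\<And>k. k \<in> I \<Longrightarrow> k \<ge> 1"
  shows "((\<lambda>y. (cmod (\<Sum>k\<in>I. c k * of_real (mode a k y)))\<^sup>2) has_integral
           (a / 2 * (\<Sum>k\<in>I. (cmod (c k))\<^sup>2))) {0..a}"
proof -
  have "(cmod (\<Sum>k\<in>I. c k * of_real (mode a k y)))\<^sup>2
      = (\<Sum>j\<in>I. \<Sum>k\<in>I. Re (c j * cnj (c k)) * (mode a j y * mode a k y))" for y
  proof -
    let ?z = "\<Sum>k\<in>I. c k * of_real (mode a k y)"
    have "(cmod ?z)\<^sup>2 = Re (?z * cnj ?z)"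
      by (simp only: complex_norm_square[symmetric] Re_complex_of_real)
    also have "?z * cnj ?z = (\<Sum>j\<in>I. \<Sum>k\<in>I. (c j * cnj (c k)) * of_real (mode a j y * mode a k y))"
      by (simp add: sum_product algebra_simps)
    finally show ?thesis by simp
  qed
  moreover have "((\<lambda>y. \<Sum>j\<in>I. \<Sum>k\<in>I. Re (c j * cnj (c k)) * (mode a j y * mode a k y)) has_integral
      (\<Sum>j\<in>I. \<Sum>k\<in>I. Re (c j * cnj (c k)) * (if j = k then a / 2 else 0))) {0..a}"
    using assms by (intro has_integral_sum has_integral_mult_right mode_orthogonal) auto
  moreover have "(\<Sum>j\<in>I. \<Sum>k\<in>I. Re (c j * cnj (c k)) * (if j = k then a / 2 else 0))
      = a / 2 * (\<Sum>k\<in>I. (cmod (c k))\<^sup>2)"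
    using assms(2) by (simp add: if_distrib sum.delta sum_distrib_left cmod_power2 cong: if_cong)
      (simp add: power2_eq_square algebra_simps)
  ultimately show ?thesis by (simp only:)
qed

definition mode_sum :: "real \<Rightarrow> nat set \<Rightarrow> (nat \<Rightarrow> real \<Rightarrow> complex) \<Rightarrow> real \<times> real \<Rightarrow> complex" where
  "mode_sum a I p z = (\<Sum>k\<in>I. p k (fst z) * of_real (mode a k (snd z)))"

lemma continuous_on_mode_sum:
  assumes "\<And>k. k \<in> I \<Longrightarrow> continuous_on UNIV (p k)"
  shows "continuous_on S (mode_sum a I p)"
  unfolding mode_sum_def[abs_def] mode_def
proof (intro continuous_on_sum continuous_on_mult)
  fix k assume "k \<in> I"
  from continuous_on_compose2[OF assms[OF this], of S fst]
  show "continuous_on S (\<lambda>z. p k (fst z))" by (simp add: continuous_on_fst)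
qed (intro continuous_intros)

text \<open>Fubini, with orthogonality on each vertical segment. It reduces norm estimates for a sum
  of modes to its coefficient functions, with no loss depending on the number of modes.\<close>

lemma mode_parseval:
  assumes "a > 0" "L > 0" "finite I" "\<And>k. k \<in> I \<Longrightarrow> k \<ge> 1"
    and p: "\<And>k. k \<in> I \<Longrightarrow> continuous_on UNIV (p k)"
  shows "integral (cbox (0, 0) (L, a)) (\<lambda>z. (cmod (mode_sum a I p z))\<^sup>2)
    = a / 2 * (\<Sum>k\<in>I. integral {0..L} (\<lambda>x. (cmod (p k x))\<^sup>2))"
proof -
  have "integral (cbox (0, 0) (L, a)) (\<lambda>z. (cmod (mode_sum a I p z))\<^sup>2)
    = integral (cbox 0 L) (\<lambda>x. integral (cbox 0 a) (\<lambda>y. (cmod (mode_sum a I p (x, y)))\<^sup>2))"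
    by (rule integral_prod_continuous) (intro continuous_intros continuous_on_mode_sum p)
  also have "\<dots> = integral {0..L} (\<lambda>x. a / 2 * (\<Sum>k\<in>I. (cmod (p k x))\<^sup>2))"
    unfolding mode_sum_def fst_conv snd_conv cbox_interval
    by (simp only: integral_unique[OF mode_parseval_1d[OF assms(1,3,4)]])
  also have "\<dots> = a / 2 * (\<Sum>k\<in>I. integral {0..L} (\<lambda>x. (cmod (p k x))\<^sup>2))"
    using assms(3) p
    by (subst integral_mult_right, subst integral_sum)
      (auto intro!: integrable_continuous_interval continuous_intros intro: continuous_on_subset)
  finally show ?thesis .
qed

subsection \<open>Density of finite sums of modes\<close>

definition mode_span :: "real \<Rightarrow> (real \<times> real \<Rightarrow> complex) set" where
  "mode_span a = {mode_sum a I p | I p. finite I \<and> (\<forall>k\<in>I. 1 \<le> k \<and> smooth1 (p k))}"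

lemma mode_span_zero: "(\<lambda>z. 0) \<in> mode_span a"
  unfolding mode_span_def mode_sum_def[abs_def] by (intro CollectI exI[of _ "{}"]) auto

lemma mode_span_single:
  assumes "smooth1 A" shows "(\<lambda>z. A (fst z) * of_real (mode a k (snd z))) \<in> mode_span a"
proof (cases "k = 0")
  case True
  then show ?thesis using mode_span_zero by (simp add: mode_def)
next
  case False
  then show ?thesis
    unfolding mode_span_def mode_sum_def[abs_def]
    using assms by (intro CollectI exI[of _ "{k}"] exI[of _ "\<lambda>_. A"]) auto
qed

lemma mode_span_add:
  assumes "g \<in> mode_span a" "h \<in> mode_span a" shows "(\<lambda>z. g z + h z) \<in> mode_span a"
proof -
  obtain I p where I: "finite I" "\<And>k. k \<in> I \<Longrightarrow> 1 \<le> k" "\<And>k. k \<in> I \<Longrightarrow> smooth1 (p k)" "g = mode_sum a I p"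
    using assms(1) unfolding mode_span_def by auto
  obtain J q where J: "finite J" "\<And>k. k \<in> J \<Longrightarrow> 1 \<le> k" "\<And>k. k \<in> J \<Longrightarrow> smooth1 (q k)" "h = mode_sum a J q"
    using assms(2) unfolding mode_span_def by auto
  define r where "r k x = (if k \<in> I then p k x else 0) + (if k \<in> J then q k x else 0)" for k x
  have "smooth1 (r k)" if "k \<in> I \<union> J" for k
    using that I(3)[of k] J(3)[of k] unfolding r_def[abs_def]
    by (cases "k \<in> I"; cases "k \<in> J") auto
  moreover have "g z + h z = mode_sum a (I \<union> J) r z" for z
  proof -
    have "mode_sum a (I \<union> J) r z = (\<Sum>k\<in>I \<union> J. if k \<in> I then p k (fst z) * of_real (mode a k (snd z)) else 0)
        + (\<Sum>k\<in>I \<union> J. if k \<in> J then q k (fst z) * of_real (mode a k (snd z)) else 0)"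
      unfolding mode_sum_def r_def sum.distrib[symmetric] by (intro sum.cong) (auto simp: algebra_simps)
    also have "\<dots> = g z + h z"
      using I(1) J(1) by (simp add: I(4) J(4) mode_sum_def sum.If_cases Int_absorb1 Un_Int_distrib2)
    finally show ?thesis by simp
  qed
  ultimately show ?thesis
    unfolding mode_span_def using I J by (intro CollectI exI[of _ "I \<union> J"] exI[of _ r]) auto
qed

lemma mode_span_sum:
  "finite I \<Longrightarrow> (\<And>k. k \<in> I \<Longrightarrow> f k \<in> mode_span a) \<Longrightarrow> (\<lambda>z. \<Sum>k\<in>I. f k z) \<in> mode_span a"
  by (induction I rule: finite_induct) (auto intro: mode_span_zero mode_span_add)

lemma mode_span_mult:
  assumes g: "g \<in> mode_span a"
    and h: "\<And>A k. smooth1 A \<Longrightarrow> (\<lambda>z. h z * (A (fst z) * of_real (mode a k (snd z)))) \<in> mode_span a"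
  shows "(\<lambda>z. h z * g z) \<in> mode_span a"
proof -
  obtain I p where I: "finite I" "\<And>k. k \<in> I \<Longrightarrow> smooth1 (p k)" "g = mode_sum a I p"
    using g unfolding mode_span_def by auto
  have "(\<lambda>z. \<Sum>k\<in>I. h z * (p k (fst z) * of_real (mode a k (snd z)))) \<in> mode_span a"
    by (intro mode_span_sum I h)
  then show ?thesis by (simp add: I(3) mode_sum_def[abs_def] sum_distrib_left)
qed

lemma mode_span_mult_fst:
  assumes "g \<in> mode_span a" "smooth1 B" shows "(\<lambda>z. B (fst z) * g z) \<in> mode_span a"
proof (rule mode_span_mult[OF assms(1)])
  fix A k assume "smooth1 A"
  then have "smooth1 (\<lambda>x. B x * A x)" using assms(2) by auto
  from mode_span_single[OF this, of a k]
  show "(\<lambda>z. B (fst z) * (A (fst z) * of_real (mode a k (snd z)))) \<in> mode_span a"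
    by (simp add: mult.assoc)
qed

text \<open>\<open>2 * cos t * sin (k * t) = sin ((k + 1) * t) + sin ((k - 1) * t)\<close>. For
  \<open>k = 1\<close> the second term is the zero function; \<open>k = 0\<close> is treated apart
  because natural subtraction truncates.\<close>

lemma mode_span_mult_cos:
  assumes "g \<in> mode_span a" shows "(\<lambda>z. of_real (cos (pi / a * snd z)) * g z) \<in> mode_span a"
proof (rule mode_span_mult[OF assms])
  fix A k assume A: "smooth1 A"
  let ?f = "\<lambda>z. of_real (cos (pi / a * snd z)) * (A (fst z) * of_real (mode a k (snd z)))"
  show "?f \<in> mode_span a"
  proof (cases "k = 0")
    case True
    then show ?thesis using mode_span_zero by (simp add: mode_def)
  next
    case False
    have "mode a (k + 1) y + mode a (k - 1) y = 2 * (cos (pi / a * y) * mode a k y)" for y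
    proof -
      have "real (k + 1) * pi / a * y = real k * pi / a * y + pi / a * y"
        "real (k - 1) * pi / a * y = real k * pi / a * y - pi / a * y"
        using False by (simp_all add: of_nat_diff add_divide_distrib diff_divide_distrib algebra_simps)
      then show ?thesis by (simp only: mode_def sin_add sin_diff) (simp add: mult.commute)
    qed
    then have "cos (pi / a * y) * mode a k y = (1 / 2) * (mode a (k + 1) y + mode a (k - 1) y)" for y
      by simp
    then have eq: "complex_of_real (cos (pi / a * y) * mode a k y)
        = complex_of_real ((1 / 2) * (mode a (k + 1) y + mode a (k - 1) y))" for y
      by (simp only:)
    have "?f z = (1 / 2 * A (fst z)) * of_real (mode a (k + 1) (snd z))
        + (1 / 2 * A (fst z)) * of_real (mode a (k - 1) (snd z))" for z
    proof -
      have "?f z = A (fst z) * complex_of_real (cos (pi / a * snd z) * mode a k (snd z))"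
        by (simp add: mult_ac)
      then show ?thesis unfolding eq by (simp add: algebra_simps)
    qed
    moreover have "smooth1 (\<lambda>x. 1 / 2 * A x)" by (rule smooth1_mult[OF smooth1_const A])
    ultimately show ?thesis
      by (simp only:) (intro mode_span_add mode_span_single)
  qed
qed

text \<open>Polynomials in \<open>x\<close> and \<open>cos (pi / a * y)\<close>, with the closure
  rules that the Stone-Weierstrass theorem asks for. The sine is left out: the span of the modes is
  stable under multiplication by the cosine, but not by the sine.\<close>

inductive_set cos_ring :: "real \<Rightarrow> (real \<times> real \<Rightarrow> real) set" for a where
  const: "(\<lambda>z. c) \<in> cos_ring a"
| fst: "fst \<in> cos_ring a"
| cos: "(\<lambda>z. cos (pi / a * snd z)) \<in> cos_ring a"
| add: "f \<in> cos_ring a \<Longrightarrow> g \<in> cos_ring a \<Longrightarrow> (\<lambda>z. f z + g z) \<in> cos_ring a"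
| mult: "f \<in> cos_ring a \<Longrightarrow> g \<in> cos_ring a \<Longrightarrow> (\<lambda>z. f z * g z) \<in> cos_ring a"

lemma cos_ring_mult_mode_span:
  "h \<in> cos_ring a \<Longrightarrow> g \<in> mode_span a \<Longrightarrow> (\<lambda>z. of_real (h z) * g z) \<in> mode_span a"
proof (induction arbitrary: g rule: cos_ring.induct)
  case (const c)
  from mode_span_mult_fst[OF const smooth1_const] show ?case .
next
  case fst
  from mode_span_mult_fst[OF fst smooth1_id] show ?case .
next
  case cos
  then show ?case by (rule mode_span_mult_cos)
next
  case (add f h)
  from mode_span_add[OF add.IH(1)[OF add.prems] add.IH(2)[OF add.prems]]
  show ?case by (simp add: distrib_right)
next
  case (mult f h)
  from mult.IH(1)[OF mult.IH(2)[OF mult.prems]]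
  show ?case by (simp add: mult.assoc)
qed

text \<open>Two points of the rectangle are separated by \<open>x\<close> or else by the cosine,
  which is injective on \<open>{0..pi}\<close>, the range of \<open>pi / a * y\<close>.\<close>

lemma cos_ring_dense:
  assumes "a > 0" "continuous_on (cbox (0, 0) (L, a)) F" "e > 0"
  obtains h where "h \<in> cos_ring a" "\<And>z. z \<in> cbox (0, 0) (L, a) \<Longrightarrow> \<bar>F z - h z\<bar> < e"
proof -
  interpret function_ring_on "cos_ring a" "cbox (0, 0) (L, a)"
  proof
    show "continuous_on (cbox (0, 0) (L, a)) f" if "f \<in> cos_ring a" for f
      using that by induction (use assms(1) in \<open>auto intro!: continuous_intros\<close>)
    fix x y :: "real \<times> real"
    assume xy: "x \<in> cbox (0, 0) (L, a)" "y \<in> cbox (0, 0) (L, a)" "x \<noteq> y"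
    show "\<exists>f\<in>cos_ring a. f x \<noteq> f y"
    proof (cases "fst x = fst y")
      case True
      then have "snd x \<noteq> snd y" using xy(3) by (simp add: prod_eq_iff)
      then have "pi / a * snd x \<noteq> pi / a * snd y" using assms(1) by simp
      moreover have "0 \<le> pi / a * snd z" "pi / a * snd z \<le> pi" if "z \<in> cbox (0, 0) (L, a)" for z
      proof -
        have "0 \<le> snd z" "snd z \<le> a" using that by (cases z; simp add: cbox_Pair_eq)+
        then show "0 \<le> pi / a * snd z" "pi / a * snd z \<le> pi"
          using assms(1) by (simp_all add: field_simps)
      qed
      ultimately have "cos (pi / a * snd x) \<noteq> cos (pi / a * snd y)"
        using xy cos_inj_pi by metis
      then show ?thesis by (rule bexI[OF _ cos_ring.cos])
    qed (rule bexI[OF _ cos_ring.fst])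
  qed (auto intro: cos_ring.intros)
  show ?thesis using Stone_Weierstrass_basic[OF assms(2,3)] that by blast
qed

text \<open>A function vanishing near \<open>y = 0\<close> and \<open>y = a\<close> stays continuous after division by the first
  mode \<open>sin (\<pi> y / a)\<close>, and multiplying a polynomial in \<open>x\<close> and \<open>cos (\<pi> y / a)\<close> back by that
  mode lands in the span of the modes.\<close>

lemma mode_span_dense:
  assumes a: "a > 0" and F: "continuous_on UNIV F"
    and K: "compact K" "K \<subseteq> UNIV \<times> {0<..<a}" "\<And>z. z \<notin> K \<Longrightarrow> F z = 0" and e: "e > 0"
  obtains g where "g \<in> mode_span a" "\<And>z. z \<in> cbox (0, 0) (L, a) \<Longrightarrow> cmod (F z - g z) < e"
proof -
  have m1: "mode a 1 y = sin (pi / a * y)" for y by (simp add: mode_def)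
  have pos: "mode a 1 (snd z) > 0" if "z \<in> K" for z
  proof -
    have "0 < snd z" "snd z < a" using K(2) that by (cases z, auto)+
    then show ?thesis unfolding m1 using a by (intro sin_gt_zero) (auto simp: field_simps)
  qed
  obtain m where m: "m > 0" "\<And>z. z \<in> K \<Longrightarrow> m \<le> mode a 1 (snd z)"
  proof (cases "K = {}")
    case False
    have "continuous_on K (\<lambda>z. mode a 1 (snd z))" unfolding m1 by (intro continuous_intros)
    then obtain w where "w \<in> K" "\<And>z. z \<in> K \<Longrightarrow> mode a 1 (snd w) \<le> mode a 1 (snd z)"
      using continuous_attains_inf[OF K(1) False] by blast
    then show ?thesis using that[of "mode a 1 (snd w)"] pos by blast
  qed (use that[of 1] in auto)
  \<comment> \<open>\<open>m\<close> is a positive lower bound of the first mode on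
    \<open>K\<close>. The maximum keeps the denominator away from 0 on the whole plane and changes
    nothing on \<open>K\<close>, outside of which \<open>F\<close> is 0.\<close>
  define G where "G z = F z / of_real (max m (mode a 1 (snd z)))" for z
  have FG: "F z = G z * of_real (mode a 1 (snd z))" for z
  proof (cases "z \<in> K")
    case True
    then show ?thesis using m(2)[OF True] pos[OF True] by (simp add: G_def max_def)
  qed (simp add: G_def K(3))
  have Gc: "continuous_on S G" for S
    unfolding G_def[abs_def] m1 using m(1) continuous_on_subset[OF F, of S]
    by (intro continuous_intros) (auto simp: max_def)
  obtain h1 where h1: "h1 \<in> cos_ring a" "\<And>z. z \<in> cbox (0, 0) (L, a) \<Longrightarrow> \<bar>Re (G z) - h1 z\<bar> < e / 2"
    by (rule cos_ring_dense[OF a _ half_gt_zero[OF e], of L "\<lambda>z. Re (G z)"]) (auto intro!: continuous_intros Gc)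
  obtain h2 where h2: "h2 \<in> cos_ring a" "\<And>z. z \<in> cbox (0, 0) (L, a) \<Longrightarrow> \<bar>Im (G z) - h2 z\<bar> < e / 2"
    by (rule cos_ring_dense[OF a _ half_gt_zero[OF e], of L "\<lambda>z. Im (G z)"]) (auto intro!: continuous_intros Gc)
  define s where "s z = complex_of_real (mode a 1 (snd z))" for z :: "real \<times> real"
  have s: "s \<in> mode_span a"
    using mode_span_single[OF smooth1_const[of 1], of a 1] by (simp add: s_def[abs_def])
  define g where "g z = of_real (h1 z) * s z + \<i> * (of_real (h2 z) * s z)" for z
  show ?thesis
  proof (rule that[of g])
    show "g \<in> mode_span a"
      unfolding g_def[abs_def]
      by (intro mode_span_add cos_ring_mult_mode_span h1 h2 s
          mode_span_mult_fst[where B="\<lambda>_. \<i>"] smooth1_const)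
    fix z :: "real \<times> real" assume z: "z \<in> cbox (0, 0) (L, a)"
    have "F z - g z = (G z - Complex (h1 z) (h2 z)) * s z"
    proof -
      have "Complex (h1 z) (h2 z) = of_real (h1 z) + \<i> * of_real (h2 z)"
        by (simp add: complex_eq_iff)
      moreover have "F z = G z * s z" using FG[of z] by (simp only: s_def)
      ultimately show ?thesis by (simp only: g_def) (simp add: algebra_simps)
    qed
    then have "cmod (F z - g z) = cmod (G z - Complex (h1 z) (h2 z)) * \<bar>mode a 1 (snd z)\<bar>"
      by (simp add: norm_mult s_def)
    also have "\<dots> \<le> cmod (G z - Complex (h1 z) (h2 z)) * 1"
      by (intro mult_left_mono) (auto simp: mode_def)
    also have "\<dots> \<le> \<bar>Re (G z) - h1 z\<bar> + \<bar>Im (G z) - h2 z\<bar>"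
      using cmod_le[of "G z - Complex (h1 z) (h2 z)"] by simp
    also have "\<dots> < e" using h1(2)[OF z] h2(2)[OF z] by linarith
    finally show "cmod (F z - g z) < e" .
  qed
qed

subsection \<open>Domains containing a rectangle of full height\<close>

text \<open>The three summands in the definition of \<open>H10\<close> are nonnegative, so each
  tends to 0. The \<open>y\<close> derivative is the one retained, because boundary terms arise at
  the horizontal sides; in \<open>x\<close> the functions tested with have compact support.\<close>

lemma H10E:
  assumes "v \<in> H10 \<Omega>"
  obtains gy \<phi> where "v \<in> L2 \<Omega>" "gy \<in> L2 \<Omega>" "\<And>n::nat. \<phi> n \<in> test_functions \<Omega>"
    "(\<lambda>n. \<integral>z. (cmod (\<phi> n z - v z))\<^sup>2 \<partial>lebesgue_on \<Omega>) \<longlonglongrightarrow> 0"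
    "(\<lambda>n. \<integral>z. (cmod (dy (\<phi> n) z - gy z))\<^sup>2 \<partial>lebesgue_on \<Omega>) \<longlonglongrightarrow> 0"
proof -
  obtain gx gy \<phi> where v: "v \<in> L2 \<Omega>" "gy \<in> L2 \<Omega>" "\<And>n::nat. \<phi> n \<in> test_functions \<Omega>"
    and lim: "(\<lambda>n. (\<integral>z. (cmod (\<phi> n z - v z))\<^sup>2 \<partial>lebesgue_on \<Omega>)
          + (\<integral>z. (cmod (dx (\<phi> n) z - gx z))\<^sup>2 \<partial>lebesgue_on \<Omega>)
          + (\<integral>z. (cmod (dy (\<phi> n) z - gy z))\<^sup>2 \<partial>lebesgue_on \<Omega>)) \<longlonglongrightarrow> 0"
    using assms unfolding H10_def by blast
  have "(\<lambda>n. \<integral>z. (cmod (\<phi> n z - v z))\<^sup>2 \<partial>lebesgue_on \<Omega>) \<longlonglongrightarrow> 0"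
    by (rule tendsto_sandwich[OF _ _ tendsto_const lim]) (auto intro!: always_eventually)
  moreover have "(\<lambda>n. \<integral>z. (cmod (dy (\<phi> n) z - gy z))\<^sup>2 \<partial>lebesgue_on \<Omega>) \<longlonglongrightarrow> 0"
    by (rule tendsto_sandwich[OF _ _ tendsto_const lim]) (auto intro!: always_eventually)
  ultimately show ?thesis using that v by blast
qed

lemma norm_add_square_le: "(norm (x + y))\<^sup>2 \<le> 2 * (norm x)\<^sup>2 + 2 * (norm y)\<^sup>2" for x y :: "'b::real_normed_vector"
proof -
  have "(norm (x + y))\<^sup>2 \<le> (norm x + norm y)\<^sup>2" by (intro power_mono norm_triangle_ineq) auto
  also have "\<dots> \<le> 2 * (norm x)\<^sup>2 + 2 * (norm y)\<^sup>2"
    using sum_squares_bound[of "norm x" "norm y"] by (simp add: power2_sum)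
  finally show ?thesis .
qed

text \<open>The geometry of the stadium that the argument sees. \<open>strip\<close> puts the lines
  \<open>y = 0\<close> and \<open>y = a\<close> outside \<Omega>, so test functions vanish there,
  and it forces \<open>x\<close> out of \<open>{0..L}\<close> at points of \<Omega> outside the
  closed rectangle; \<open>rect\<close> makes room for test functions supported in the open
  rectangle.\<close>

locale strip_domain =
  fixes \<Omega> :: "(real \<times> real) set" and L a :: real
  assumes opn: "open \<Omega>" and bdd: "bounded \<Omega>" and L: "L > 0" and a: "a > 0"
    and strip: "\<Omega> \<subseteq> UNIV \<times> {0<..<a}" and rect: "{0<..<L} \<times> {0<..<a} \<subseteq> \<Omega>"
begin

abbreviation "M \<equiv> lebesgue_on \<Omega>"
abbreviation "R \<equiv> cbox (0, 0) (L, a)"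

lemma sets_\<Omega> [simp]: "\<Omega> \<in> sets lebesgue"
  using opn by auto

sublocale finite_measure M
  by (intro finite_measure_lebesgue_on lmeasurable_open bdd opn)

lemma measurable_continuous [intro]:
  "continuous_on UNIV (b :: real \<times> real \<Rightarrow> 'b::topological_space) \<Longrightarrow> b \<in> borel_measurable M"
  by (rule continuous_imp_measurable_on_sets_lebesgue) (auto intro: continuous_on_subset)

lemma bounded_continuous:
  fixes b :: "real \<times> real \<Rightarrow> 'b::real_normed_vector"
  assumes "continuous_on UNIV b"
  obtains B where "B \<ge> 0" "\<And>z. z \<in> \<Omega> \<Longrightarrow> norm (b z) \<le> B"
proof -
  have "compact (closure \<Omega>)" using bdd by (simp add: compact_closure)
  then have "bounded (b ` closure \<Omega>)"
    by (intro compact_imp_bounded compact_continuous_image continuous_on_subset[OF assms]) auto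
  then obtain B where "\<And>z. z \<in> closure \<Omega> \<Longrightarrow> norm (b z) \<le> B" by (auto simp: bounded_iff)
  then have "norm (b z) \<le> \<bar>B\<bar>" if "z \<in> \<Omega>" for z
    using that closure_subset[of \<Omega>] by (meson abs_ge_self order_trans subsetD)
  then show ?thesis using that[of "\<bar>B\<bar>"] by auto
qed

section \<open>Square-integrable functions paired with continuous ones\<close>

lemma L2_measurable: "v \<in> L2 \<Omega> \<Longrightarrow> v \<in> borel_measurable M"
  and L2_square: "v \<in> L2 \<Omega> \<Longrightarrow> integrable M (\<lambda>z. (cmod (v z))\<^sup>2)"
  by (auto simp: L2_def)

lemma L2_integrable_norm:
  assumes "v \<in> L2 \<Omega>" shows "integrable M (\<lambda>z. cmod (v z))"
proof (rule Bochner_Integration.integrable_bound)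
  show "integrable M (\<lambda>z. 1 + (cmod (v z))\<^sup>2)" using L2_square[OF assms] by simp
  show "AE z in M. norm (cmod (v z)) \<le> norm (1 + (cmod (v z))\<^sup>2)"
  proof (rule AE_I2)
    show "norm (cmod (v z)) \<le> norm (1 + (cmod (v z))\<^sup>2)" for z
      using sum_squares_bound[of 1 "cmod (v z)"] norm_ge_zero[of "v z"] by (simp del: norm_ge_zero)
  qed
qed (use L2_measurable[OF assms] in measurable)

lemma L2_mult_integrable:
  assumes v: "v \<in> L2 \<Omega>" and b: "continuous_on UNIV b"
  shows "integrable M (\<lambda>z. v z * b z)"
proof -
  obtain B where B: "B \<ge> 0" "\<And>z. z \<in> \<Omega> \<Longrightarrow> norm (b z) \<le> B" using bounded_continuous[OF b] by blast
  show ?thesis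
  proof (rule Bochner_Integration.integrable_bound)
    show "integrable M (\<lambda>z. B * cmod (v z))" using L2_integrable_norm[OF v] by simp
    show "AE z in M. norm (v z * b z) \<le> norm (B * cmod (v z))"
      using B by (intro AE_I2) (simp add: norm_mult mult.commute[of B] mult_left_mono)
    show "(\<lambda>z. v z * b z) \<in> borel_measurable M"
      using L2_measurable[OF v] measurable_continuous[OF b] by measurable
  qed
qed

lemma integrable_continuous_\<Omega>:
  fixes b :: "real \<times> real \<Rightarrow> 'b::{banach, second_countable_topology}"
  assumes "continuous_on UNIV b"
  shows "integrable M b"
proof -
  obtain B where B: "B \<ge> 0" "\<And>z. z \<in> \<Omega> \<Longrightarrow> norm (b z) \<le> B" using bounded_continuous[OF assms] by blast
  show ?thesis
    by (rule integrable_const_bound[of _ B]) (use B assms in auto)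
qed

lemma L2_continuous:
  assumes "continuous_on UNIV b" shows "b \<in> L2 \<Omega>"
  unfolding L2_def using assms by (auto intro!: integrable_continuous_\<Omega> continuous_intros)

lemma L2_diff:
  assumes "u \<in> L2 \<Omega>" "v \<in> L2 \<Omega>" shows "(\<lambda>z. u z - v z) \<in> L2 \<Omega>"
proof -
  have m: "(\<lambda>z. u z - v z) \<in> borel_measurable M" using assms L2_measurable by measurable
  have "integrable M (\<lambda>z. (cmod (u z - v z))\<^sup>2)"
  proof (rule Bochner_Integration.integrable_bound)
    show "integrable M (\<lambda>z. 2 * (cmod (u z))\<^sup>2 + 2 * (cmod (v z))\<^sup>2)"
      using assms L2_square by (intro Bochner_Integration.integrable_add integrable_mult_right) auto
    show "AE z in M. norm ((cmod (u z - v z))\<^sup>2) \<le> norm (2 * (cmod (u z))\<^sup>2 + 2 * (cmod (v z))\<^sup>2)"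
      using norm_add_square_le[of "u _" "- v _"] by (intro AE_I2) simp
  qed (use m in measurable)
  with m show ?thesis by (auto simp: L2_def)
qed

text \<open>Young's inequality with a moving weight:
  \<open>cmod h \<le> e + (cmod h)\<^sup>2 / e\<close>, where \<open>e n\<close> is slightly larger
  than \<open>sqrt (d n)\<close>. Both \<open>e n\<close> and \<open>d n / e n\<close> tend to 0;
  the summand \<open>1 / real (Suc n)\<close> keeps the weight positive where
  \<open>d n = 0\<close>.\<close>

lemma L2_limit_mult:
  assumes h: "\<And>n. h n \<in> L2 \<Omega>" and lim: "(\<lambda>n. \<integral>z. (cmod (h n z))\<^sup>2 \<partial>M) \<longlonglongrightarrow> 0"
    and b: "continuous_on UNIV b"
  shows "(\<lambda>n. \<integral>z. h n z * b z \<partial>M) \<longlonglongrightarrow> 0"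
proof -
  obtain B where B: "B \<ge> 0" "\<And>z. z \<in> \<Omega> \<Longrightarrow> norm (b z) \<le> B" using bounded_continuous[OF b] by blast
  define d where "d n = (\<integral>z. (cmod (h n z))\<^sup>2 \<partial>M)" for n
  define e where "e n = sqrt (d n) + 1 / real (Suc n)" for n
  have d0: "d n \<ge> 0" for n by (simp add: d_def)
  have e0: "e n > 0" for n using d0[of n] by (auto simp: e_def intro: add_nonneg_pos)
  have de: "d n / e n \<le> sqrt (d n)" for n
  proof -
    have "d n = sqrt (d n) * sqrt (d n)" using d0[of n] by simp
    also have "\<dots> \<le> sqrt (d n) * e n" using d0[of n] by (intro mult_left_mono) (auto simp: e_def)
    finally show ?thesis using e0[of n] by (simp add: divide_le_eq)
  qed
  have bound: "norm (\<integral>z. h n z * b z \<partial>M) \<le> B * (e n * measure M \<Omega> + sqrt (d n))" for n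
  proof -
    have "norm (\<integral>z. h n z * b z \<partial>M) \<le> (\<integral>z. norm (h n z * b z) \<partial>M)"
      by (rule integral_norm_bound)
    also have "\<dots> \<le> (\<integral>z. B * (e n + (cmod (h n z))\<^sup>2 / e n) \<partial>M)"
    proof (rule integral_mono)
      show "integrable M (\<lambda>z. norm (h n z * b z))"
        using L2_mult_integrable[OF h b] by (rule integrable_norm)
      show "integrable M (\<lambda>z. B * (e n + (cmod (h n z))\<^sup>2 / e n))"
        using L2_square[OF h] by simp
      fix z assume "z \<in> space M"
      then have "norm (h n z * b z) \<le> B * cmod (h n z)"
        using B by (simp add: norm_mult mult.commute[of B] mult_left_mono)
      moreover have "cmod (h n z) \<le> e n + (cmod (h n z))\<^sup>2 / e n"
      proof -
        have "2 * e n * cmod (h n z) \<le> (e n)\<^sup>2 + (cmod (h n z))\<^sup>2" by (rule sum_squares_bound)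
        moreover have "0 \<le> e n * cmod (h n z)" using e0[of n] by simp
        ultimately have "e n * cmod (h n z) \<le> (e n)\<^sup>2 + (cmod (h n z))\<^sup>2" by simp
        then show ?thesis using e0[of n] by (simp add: field_simps power2_eq_square)
      qed
      ultimately show "norm (h n z * b z) \<le> B * (e n + (cmod (h n z))\<^sup>2 / e n)"
        using B(1) by (meson mult_left_mono order_trans)
    qed
    also have "\<dots> = B * (e n * measure M \<Omega> + d n / e n)"
      using L2_square[OF h] by (simp add: d_def)
    also have "\<dots> \<le> B * (e n * measure M \<Omega> + sqrt (d n))"
      using B(1) de by (intro mult_left_mono) auto
    finally show ?thesis .
  qed
  have ds: "(\<lambda>n. sqrt (d n)) \<longlonglongrightarrow> 0"
    using tendsto_real_sqrt[OF lim] by (simp add: d_def)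
  have "e \<longlonglongrightarrow> 0 + 0"
    unfolding e_def[abs_def] by (intro tendsto_add ds LIMSEQ_Suc[OF lim_1_over_n])
  then have "(\<lambda>n. B * (e n * measure M \<Omega> + sqrt (d n))) \<longlonglongrightarrow> B * (0 * measure M \<Omega> + 0)"
    by (intro tendsto_intros ds) simp
  then have "(\<lambda>n. B * (e n * measure M \<Omega> + sqrt (d n))) \<longlonglongrightarrow> 0" by simp
  then show ?thesis
    by (rule Lim_null_comparison[rotated]) (use bound in \<open>auto intro!: always_eventually\<close>)
qed

section \<open>Vertical integration by parts and the zero trace\<close>

text \<open>Leads from \<Omega>, where the weak formulation lives, to the closed rectangle, where
  Fubini applies. Either set may have points outside the other, hence the two vanishing
  conditions.\<close>

lemma integral_on_rectangle:
  fixes F :: "real \<times> real \<Rightarrow> 'b::euclidean_space"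
  assumes "continuous_on R F"
    and "\<And>z. z \<in> \<Omega> - R \<Longrightarrow> F z = 0" "\<And>z. z \<in> R - \<Omega> \<Longrightarrow> F z = 0"
  shows "(\<integral>z. F z \<partial>M) = integral R F"
proof -
  have "(\<integral>z. F z \<partial>M) = (\<integral>z. indicator \<Omega> z *\<^sub>R F z \<partial>lebesgue)"
    by (intro integral_restrict_space) simp
  also have "\<dots> = (\<integral>z. indicator R z *\<^sub>R F z \<partial>lebesgue)"
    using assms(2,3) by (intro Bochner_Integration.integral_cong) (auto simp: indicator_def)
  also have "\<dots> = (\<integral>z. F z \<partial>lebesgue_on R)"
    by (intro integral_restrict_space[symmetric]) simp
  also have "\<dots> = integral R F"
    by (intro lebesgue_integral_eq_integral continuous_imp_integrable assms(1)) simp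
  finally show ?thesis .
qed

text \<open>The boundary terms at \<open>y = 0\<close> and \<open>y = a\<close> vanish because
  \<open>\<phi>\<close> does, so \<open>T\<close> is free to be nonzero there. In this form the zero
  trace survives the passage to the limit.\<close>

lemma test_function_ibp_y:
  assumes \<phi>: "\<phi> \<in> test_functions \<Omega>" and \<theta>: "continuous_on UNIV \<theta>" "\<And>x. x \<notin> {0..L} \<Longrightarrow> \<theta> x = 0"
    and T: "continuous_on UNIV T" "\<And>y. (T has_vector_derivative T' y) (at y)" "continuous_on UNIV T'"
  shows "(\<integral>z. \<phi> z * tensor \<theta> T' z \<partial>M) = - (\<integral>z. dy \<phi> z * tensor \<theta> T z \<partial>M)"
proof -
  note c = test_function_continuous[OF \<phi>] test_function_continuous_dy[OF \<phi>]
  define F where "F z = \<phi> z * tensor \<theta> T' z + dy \<phi> z * tensor \<theta> T z" for z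
  have Fc: "continuous_on S F" for S
    unfolding F_def[abs_def] by (intro continuous_intros c continuous_on_tensor \<theta> T)
  have "(\<integral>z. F z \<partial>M) = integral R F"
  proof (rule integral_on_rectangle[OF Fc])
    show "F z = 0" if "z \<in> \<Omega> - R" for z
    proof -
      have "fst z \<notin> {0..L}" using that strip by (cases z) auto
      then show ?thesis using \<theta>(2) by (simp add: F_def tensor_def)
    qed
    show "F z = 0" if "z \<in> R - \<Omega>" for z
      using that test_function_outside[OF \<phi>, of z] test_function_dy_outside[OF \<phi>, of z] by (simp add: F_def)
  qed
  also have "\<dots> = integral (cbox 0 L) (\<lambda>x. integral (cbox 0 a) (\<lambda>y. F (x, y)))"
    by (rule integral_prod_continuous) (rule Fc)
  also have "\<dots> = 0"
  proof -
    have "integral {0..a} (\<lambda>y. F (x, y)) = 0" for x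
    proof -
      let ?h = "\<lambda>y. \<phi> (x, y) * (\<theta> x * T y)"
      have "(?h has_vector_derivative F (x, y)) (at y)" for y
        unfolding F_def tensor_def fst_conv snd_conv
        by (intro has_vector_derivative_mult has_vector_derivative_mult_right T test_function_deriv_y[OF \<phi>])
      then have "((\<lambda>y. F (x, y)) has_integral ?h a - ?h 0) {0..a}"
        using a by (intro fundamental_theorem_of_calculus) (auto intro: has_vector_derivative_at_within)
      moreover have "(x, a) \<notin> \<Omega>" "(x, 0) \<notin> \<Omega>" using strip by auto
      ultimately show ?thesis using test_function_outside[OF \<phi>] by (simp add: integral_unique)
    qed
    then show ?thesis by simp
  qed
  finally show ?thesis
    unfolding F_def
    by (subst (asm) Bochner_Integration.integral_add)
      (auto intro!: integrable_continuous_\<Omega> continuous_intros c continuous_on_tensor \<theta> T simp: eq_neg_iff_add_eq_0)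
qed

text \<open>One \<open>gy\<close>, the limit of the derivatives of approximating test functions,
  serves all \<open>\<theta>\<close> and \<open>T\<close>, since both sides are continuous in
  \<open>L2\<close>. As \<open>T\<close> may be nonzero at the sides, the formula says more than the
  weak gradient and expresses the zero trace.\<close>

lemma H10_ibp_y:
  assumes v: "v \<in> H10 \<Omega>"
  obtains gy where "gy \<in> L2 \<Omega>"
    "\<And>\<theta> T T'. continuous_on UNIV \<theta> \<Longrightarrow> (\<And>x. x \<notin> {0..L} \<Longrightarrow> \<theta> x = 0) \<Longrightarrow>
      continuous_on UNIV T \<Longrightarrow> (\<And>y. (T has_vector_derivative T' y) (at y)) \<Longrightarrow> continuous_on UNIV T' \<Longrightarrow>
      (\<integral>z. v z * tensor \<theta> T' z \<partial>M) = - (\<integral>z. gy z * tensor \<theta> T z \<partial>M)"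
proof -
  obtain gy \<phi> where H: "v \<in> L2 \<Omega>" "gy \<in> L2 \<Omega>" "\<And>n::nat. \<phi> n \<in> test_functions \<Omega>"
    "(\<lambda>n. \<integral>z. (cmod (\<phi> n z - v z))\<^sup>2 \<partial>M) \<longlonglongrightarrow> 0"
    "(\<lambda>n. \<integral>z. (cmod (dy (\<phi> n) z - gy z))\<^sup>2 \<partial>M) \<longlonglongrightarrow> 0"
    using H10E[OF v] by blast
  note \<phi>L = L2_continuous[OF test_function_continuous[OF H(3)]] L2_continuous[OF test_function_continuous_dy[OF H(3)]]
  have lim: "(\<lambda>n. \<integral>z. u n z * b z \<partial>M) \<longlonglongrightarrow> (\<integral>z. w z * b z \<partial>M)"
    if "\<And>n. u n \<in> L2 \<Omega>" "w \<in> L2 \<Omega>" "(\<lambda>n. \<integral>z. (cmod (u n z - w z))\<^sup>2 \<partial>M) \<longlonglongrightarrow> 0" "continuous_on UNIV b"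
    for u w b
  proof -
    have "(\<lambda>n. \<integral>z. (u n z - w z) * b z \<partial>M) \<longlonglongrightarrow> 0"
      by (rule L2_limit_mult[OF L2_diff[OF that(1,2)] that(3,4)])
    moreover have "(\<integral>z. (u n z - w z) * b z \<partial>M) = (\<integral>z. u n z * b z \<partial>M) - (\<integral>z. w z * b z \<partial>M)" for n
      using that by (simp add: left_diff_distrib L2_mult_integrable Bochner_Integration.integral_diff)
    ultimately show ?thesis by (simp add: LIM_zero_iff)
  qed
  show ?thesis
  proof (rule that[OF H(2)])
    fix \<theta> T T' :: "real \<Rightarrow> complex"
    assume A: "continuous_on UNIV \<theta>" "\<And>x. x \<notin> {0..L} \<Longrightarrow> \<theta> x = 0"
      "continuous_on UNIV T" "\<And>y. (T has_vector_derivative T' y) (at y)" "continuous_on UNIV T'"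
    have "(\<lambda>n. \<integral>z. \<phi> n z * tensor \<theta> T' z \<partial>M) \<longlonglongrightarrow> (\<integral>z. v z * tensor \<theta> T' z \<partial>M)"
      by (intro lim \<phi>L H continuous_on_tensor A)
    moreover have "(\<lambda>n. - (\<integral>z. dy (\<phi> n) z * tensor \<theta> T z \<partial>M)) \<longlonglongrightarrow> - (\<integral>z. gy z * tensor \<theta> T z \<partial>M)"
      by (intro tendsto_minus lim \<phi>L H continuous_on_tensor A)
    ultimately show "(\<integral>z. v z * tensor \<theta> T' z \<partial>M) = - (\<integral>z. gy z * tensor \<theta> T z \<partial>M)"
      using test_function_ibp_y[OF H(3) A] LIMSEQ_unique by auto
  qed
qed

text \<open>Dominated convergence. Limits are asked for in the open interval, as \<Omega> lies in
  the open strip; the derivatives \<open>T' j\<close> of \<open>sine_cutoff\<close> vanish at the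
  sides and do not converge to the cosine there.\<close>

lemma tendsto_integral_tensor:
  assumes u: "u \<in> L2 \<Omega>" and \<theta>: "continuous_on UNIV \<theta>"
    and T: "\<And>j. continuous_on UNIV (T j)" "continuous_on UNIV T\<^sub>0"
    and bound: "\<And>j y. cmod (T j y) \<le> C"
    and lim: "\<And>y. y \<in> {0<..<a} \<Longrightarrow> (\<lambda>j. T j y) \<longlonglongrightarrow> T\<^sub>0 y"
  shows "(\<lambda>j::nat. \<integral>z. u z * tensor \<theta> (T j) z \<partial>M) \<longlonglongrightarrow> (\<integral>z. u z * tensor \<theta> T\<^sub>0 z \<partial>M)"
proof (rule integral_dominated_convergence)
  have c1: "continuous_on UNIV (\<lambda>z :: real \<times> real. \<theta> (fst z))"
    using continuous_on_tensor[OF \<theta> continuous_on_const, of UNIV 1] by (simp add: tensor_def[abs_def])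
  have "integrable M (\<lambda>z. norm (u z * \<theta> (fst z)))"
    by (intro integrable_norm L2_mult_integrable u c1)
  then show "integrable M (\<lambda>z. norm (u z * \<theta> (fst z)) * C)" by simp
  show "(\<lambda>z. u z * tensor \<theta> T\<^sub>0 z) \<in> borel_measurable M"
    by (intro borel_measurable_integrable L2_mult_integrable u continuous_on_tensor \<theta> T)
  show "(\<lambda>z. u z * tensor \<theta> (T j) z) \<in> borel_measurable M" for j
    by (intro borel_measurable_integrable L2_mult_integrable u continuous_on_tensor \<theta> T)
  show "AE z in M. (\<lambda>j. u z * tensor \<theta> (T j) z) \<longlonglongrightarrow> u z * tensor \<theta> T\<^sub>0 z"
    unfolding tensor_def
    by (rule AE_I2, intro tendsto_mult tendsto_const lim) (use strip in auto)
  show "AE z in M. norm (u z * tensor \<theta> (T j) z) \<le> norm (u z * \<theta> (fst z)) * C" for j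
    unfolding tensor_def norm_mult mult.assoc[symmetric]
    by (rule AE_I2, intro mult_left_mono bound) auto
qed

text \<open>The sine is not compactly supported in the strip, so the equation is tested with
  truncated sines. Their second derivatives are unbounded in the boundary layers; trading
  \<open>v\<close> and \<open>t'' j\<close> for \<open>gy\<close> and \<open>t' j\<close> leaves
  quantities that converge.\<close>

lemma mode_identity:
  assumes v: "v \<in> H10 \<Omega>" and f: "f \<in> L2 \<Omega>" and eq: "helmholtz_distributional \<Omega> k v f"
    and \<theta>: "smooth1 \<theta>" "\<And>x. (\<theta> has_vector_derivative \<theta>' x) (at x)" "\<And>x. (\<theta>' has_vector_derivative \<theta>'' x) (at x)"
    and supp: "0 < l" "r < L" "\<And>x. x \<notin> {l..r} \<Longrightarrow> \<theta> x = 0"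
    and \<kappa>: "\<kappa> > 0" "sin (\<kappa> * a) = 0"
  defines "s \<equiv> \<lambda>y. complex_of_real (sin (\<kappa> * y))"
  shows "(\<integral>z. v z * (tensor \<theta>'' s z + of_real (k\<^sup>2 - \<kappa>\<^sup>2) * tensor \<theta> s z) \<partial>M) = - (\<integral>z. f z * tensor \<theta> s z \<partial>M)"
proof -
  obtain gy where gy: "gy \<in> L2 \<Omega>" and ibp:
    "\<And>\<theta> T T'. continuous_on UNIV \<theta> \<Longrightarrow> (\<And>x. x \<notin> {0..L} \<Longrightarrow> \<theta> x = 0) \<Longrightarrow>
      continuous_on UNIV T \<Longrightarrow> (\<And>y. (T has_vector_derivative T' y) (at y)) \<Longrightarrow> continuous_on UNIV T' \<Longrightarrow>
      (\<integral>z. v z * tensor \<theta> T' z \<partial>M) = - (\<integral>z. gy z * tensor \<theta> T z \<partial>M)"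
    using H10_ibp_y[OF v] by blast
  have vL: "v \<in> L2 \<Omega>" using v by (auto simp: H10_def)
  have s\<theta>': "smooth1 \<theta>'" by (rule smooth1_deriv[OF \<theta>(1,2)])
  have s\<theta>'': "smooth1 \<theta>''" by (rule smooth1_deriv[OF s\<theta>' \<theta>(3)])
  note ct = smooth1_continuous[OF \<theta>(1)] smooth1_continuous[OF s\<theta>'']
  have supp0: "x \<notin> {0..L} \<Longrightarrow> \<theta> x = 0" for x using supp by auto
  define c where "c y = complex_of_real (\<kappa> * cos (\<kappa> * y))" for y
  have ss: "smooth1 s" unfolding s_def by (rule smooth1_sin)
  have s': "(s has_vector_derivative c y) (at y)" for y
    unfolding s_def c_def by (rule has_vector_derivative_of_real)
      (auto intro!: derivative_eq_intros simp flip: has_real_derivative_iff_has_vector_derivative)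
  have cc: "smooth1 c" by (rule smooth1_deriv[OF ss s'])
  have c': "(c has_vector_derivative - of_real (\<kappa>\<^sup>2) * s y) (at y)" for y
  proof -
    have "((\<lambda>y. complex_of_real (\<kappa> * cos (\<kappa> * y))) has_vector_derivative of_real (- \<kappa>\<^sup>2 * sin (\<kappa> * y))) (at y)"
      by (rule has_vector_derivative_of_real)
        (auto intro!: derivative_eq_intros simp: power2_eq_square simp flip: has_real_derivative_iff_has_vector_derivative)
    then show ?thesis by (simp add: c_def[abs_def] s_def)
  qed
  obtain T T' \<delta> C where T: "\<And>j. smooth1 (\<lambda>y. of_real (T j y))"
    "\<And>j y. (T j has_field_derivative T' j y) (at y)"
    "\<And>j. 0 < \<delta> j" "\<And>j y. y \<notin> {\<delta> j..a - \<delta> j} \<Longrightarrow> T j y = 0"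
    "\<And>j y. \<bar>T j y\<bar> \<le> 1" "\<And>j y. \<bar>T' j y\<bar> \<le> C"
    "\<And>y. y \<in> {0<..<a} \<Longrightarrow> (\<lambda>j. T j y) \<longlonglongrightarrow> sin (\<kappa> * y)"
    "\<And>y. y \<in> {0<..<a} \<Longrightarrow> (\<lambda>j. T' j y) \<longlonglongrightarrow> \<kappa> * cos (\<kappa> * y)"
    by (rule sine_cutoff[OF a \<kappa>(2,1)]) (rule that; assumption)
  define t t' where "t j y = complex_of_real (T j y)" and "t' j y = complex_of_real (T' j y)" for j :: nat and y
  have t: "smooth1 (t j)" "(t j has_vector_derivative t' j y) (at y)" for j y
    unfolding t_def[abs_def] t'_def
    by (rule T(1), rule has_vector_derivative_of_real)
      (simp add: T(2) flip: has_real_derivative_iff_has_vector_derivative)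
  have t': "smooth1 (t' j)" for j by (rule smooth1_deriv[OF t])
  have "\<exists>g. (\<forall>y. (t' j has_vector_derivative g y) (at y)) \<and> smooth1 g" for j
    using smooth1E[OF t'[of j]] by blast
  then obtain t'' where t'': "\<And>j y. (t' j has_vector_derivative t'' j y) (at y)" "\<And>j. smooth1 (t'' j)"
    by metis
  note tc = smooth1_continuous[OF t(1)] smooth1_continuous[OF t'] smooth1_continuous[OF t''(2)]
  have eq_j: "(\<integral>z. v z * tensor \<theta>'' (t j) z \<partial>M) - (\<integral>z. gy z * tensor \<theta> (t' j) z \<partial>M)
      + of_real (k\<^sup>2) * (\<integral>z. v z * tensor \<theta> (t j) z \<partial>M) = - (\<integral>z. f z * tensor \<theta> (t j) z \<partial>M)" for j
  proof -
    have "tensor \<theta> (t j) \<in> test_functions \<Omega>"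
    proof (rule tensor_test_function[OF \<theta>(1) t(1) supp(3)])
      show "y \<notin> {\<delta> j..a - \<delta> j} \<Longrightarrow> t j y = 0" for y using T(4) by (simp add: t_def)
      have "{l..r} \<times> {\<delta> j..a - \<delta> j} \<subseteq> {0<..<L} \<times> {0<..<a}" using supp T(3)[of j] by auto
      then show "{l..r} \<times> {\<delta> j..a - \<delta> j} \<subseteq> \<Omega>" using rect by blast
    qed auto
    with eq have "(\<integral>z. f z * tensor \<theta> (t j) z \<partial>M)
        = (\<integral>z. v z * (- laplacian (tensor \<theta> (t j)) z - (of_real k)\<^sup>2 * tensor \<theta> (t j) z) \<partial>M)"
      unfolding helmholtz_distributional_def by simp
    also have "\<dots> = (\<integral>z. - (v z * tensor \<theta>'' (t j) z + v z * tensor \<theta> (t'' j) z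
        + of_real (k\<^sup>2) * (v z * tensor \<theta> (t j) z)) \<partial>M)"
      by (simp add: laplacian_tensor[OF \<theta>(2,3) t(2) t''(1)] algebra_simps)
    also have "\<dots> = - ((\<integral>z. v z * tensor \<theta>'' (t j) z \<partial>M) + (\<integral>z. v z * tensor \<theta> (t'' j) z \<partial>M)
        + of_real (k\<^sup>2) * (\<integral>z. v z * tensor \<theta> (t j) z \<partial>M))"
      by (simp add: L2_mult_integrable[OF vL] continuous_on_tensor ct tc)
    also have "(\<integral>z. v z * tensor \<theta> (t'' j) z \<partial>M) = - (\<integral>z. gy z * tensor \<theta> (t' j) z \<partial>M)"
      by (rule ibp[OF ct(1) supp0 tc(2) t''(1) tc(3)])
    finally show ?thesis by simp
  qed
  have lim_t: "(\<lambda>j. \<integral>z. u z * tensor A (t j) z \<partial>M) \<longlonglongrightarrow> (\<integral>z. u z * tensor A s z \<partial>M)"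
    if "u \<in> L2 \<Omega>" "continuous_on UNIV A" for u A
    by (rule tendsto_integral_tensor[OF that tc(1) smooth1_continuous[OF ss], where C=1])
      (auto simp: t_def s_def T(5,7) intro!: tendsto_of_real)
  have lim_t': "(\<lambda>j. \<integral>z. gy z * tensor \<theta> (t' j) z \<partial>M) \<longlonglongrightarrow> (\<integral>z. gy z * tensor \<theta> c z \<partial>M)"
    by (rule tendsto_integral_tensor[OF gy ct(1) tc(2) smooth1_continuous[OF cc], where C=C])
      (use T(6,8) in \<open>auto simp: t'_def c_def simp del: of_real_mult intro!: tendsto_of_real\<close>)
  have "(\<lambda>j. (\<integral>z. v z * tensor \<theta>'' (t j) z \<partial>M) - (\<integral>z. gy z * tensor \<theta> (t' j) z \<partial>M)
      + of_real (k\<^sup>2) * (\<integral>z. v z * tensor \<theta> (t j) z \<partial>M)) \<longlonglongrightarrow>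
      (\<integral>z. v z * tensor \<theta>'' s z \<partial>M) - (\<integral>z. gy z * tensor \<theta> c z \<partial>M)
      + of_real (k\<^sup>2) * (\<integral>z. v z * tensor \<theta> s z \<partial>M)"
    by (intro tendsto_intros lim_t lim_t' vL ct)
  moreover have "(\<lambda>j. - (\<integral>z. f z * tensor \<theta> (t j) z \<partial>M)) \<longlonglongrightarrow> - (\<integral>z. f z * tensor \<theta> s z \<partial>M)"
    by (intro tendsto_minus lim_t f ct)
  ultimately have e1: "(\<integral>z. v z * tensor \<theta>'' s z \<partial>M) - (\<integral>z. gy z * tensor \<theta> c z \<partial>M)
      + of_real (k\<^sup>2) * (\<integral>z. v z * tensor \<theta> s z \<partial>M) = - (\<integral>z. f z * tensor \<theta> s z \<partial>M)"
    unfolding eq_j by (rule LIMSEQ_unique)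
  \<comment> \<open>The integration by parts is undone in the limit. The cosine \<open>c\<close>
    does not vanish at the sides; the zero trace of \<open>v\<close> makes the formula available all
    the same.\<close>
  have e2: "- (\<integral>z. gy z * tensor \<theta> c z \<partial>M) = - of_real (\<kappa>\<^sup>2) * (\<integral>z. v z * tensor \<theta> s z \<partial>M)"
  proof -
    have "(\<integral>z. v z * tensor \<theta> (\<lambda>y. - of_real (\<kappa>\<^sup>2) * s y) z \<partial>M) = - (\<integral>z. gy z * tensor \<theta> c z \<partial>M)"
      by (rule ibp[OF ct(1) supp0 smooth1_continuous[OF cc] c'])
        (auto intro!: continuous_intros smooth1_continuous[OF ss])
    moreover have "(\<integral>z. v z * tensor \<theta> (\<lambda>y. - of_real (\<kappa>\<^sup>2) * s y) z \<partial>M)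
        = (\<integral>z. - of_real (\<kappa>\<^sup>2) * (v z * tensor \<theta> s z) \<partial>M)"
      by (simp add: tensor_def algebra_simps)
    ultimately show ?thesis by (simp only: integral_mult_right_zero)
  qed
  have e3: "(\<integral>z. v z * (tensor \<theta>'' s z + of_real (k\<^sup>2 - \<kappa>\<^sup>2) * tensor \<theta> s z) \<partial>M)
      = (\<integral>z. v z * tensor \<theta>'' s z \<partial>M) + of_real (k\<^sup>2 - \<kappa>\<^sup>2) * (\<integral>z. v z * tensor \<theta> s z \<partial>M)"
  proof -
    have "(\<integral>z. v z * (tensor \<theta>'' s z + of_real (k\<^sup>2 - \<kappa>\<^sup>2) * tensor \<theta> s z) \<partial>M)
      = (\<integral>z. v z * tensor \<theta>'' s z + of_real (k\<^sup>2 - \<kappa>\<^sup>2) * (v z * tensor \<theta> s z) \<partial>M)"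
      by (simp add: algebra_simps)
    also have "\<dots> = (\<integral>z. v z * tensor \<theta>'' s z \<partial>M) + (\<integral>z. of_real (k\<^sup>2 - \<kappa>\<^sup>2) * (v z * tensor \<theta> s z) \<partial>M)"
      by (intro Bochner_Integration.integral_add integrable_mult_right L2_mult_integrable vL
          continuous_on_tensor ct smooth1_continuous[OF ss])
    finally show ?thesis by (simp only: integral_mult_right_zero)
  qed
  have "(\<integral>z. v z * tensor \<theta>'' s z \<partial>M) + of_real (k\<^sup>2 - \<kappa>\<^sup>2) * (\<integral>z. v z * tensor \<theta> s z \<partial>M)
      = (\<integral>z. v z * tensor \<theta>'' s z \<partial>M) + - of_real (\<kappa>\<^sup>2) * (\<integral>z. v z * tensor \<theta> s z \<partial>M)
        + of_real (k\<^sup>2) * (\<integral>z. v z * tensor \<theta> s z \<partial>M)"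
    by (simp add: algebra_simps)
  also have "\<dots> = - (\<integral>z. f z * tensor \<theta> s z \<partial>M)"
    using e1 by (simp only: e2[symmetric] diff_conv_add_uminus)
  finally show ?thesis by (simp only: e3)
qed

text \<open>Cauchy-Schwarz in additive form; the weight \<open>t\<close> stays free so that the
  second term can be made small.\<close>

lemma L2_young:
  assumes u: "u \<in> L2 \<Omega>" and q: "continuous_on UNIV q" and t: "t > 0"
  shows "cmod (\<integral>z. u z * q z \<partial>M) \<le> t / 2 * (\<integral>z. (cmod (u z))\<^sup>2 \<partial>M) + 1 / (2 * t) * (\<integral>z. (cmod (q z))\<^sup>2 \<partial>M)"
proof -
  have q2: "integrable M (\<lambda>z. (cmod (q z))\<^sup>2)"
    by (intro integrable_continuous_\<Omega> continuous_intros q)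
  have "cmod (\<integral>z. u z * q z \<partial>M) \<le> (\<integral>z. cmod (u z * q z) \<partial>M)"
    by (rule integral_norm_bound)
  also have "\<dots> \<le> (\<integral>z. t / 2 * (cmod (u z))\<^sup>2 + 1 / (2 * t) * (cmod (q z))\<^sup>2 \<partial>M)"
  proof (rule integral_mono)
    show "integrable M (\<lambda>z. cmod (u z * q z))"
      by (intro integrable_norm L2_mult_integrable u q)
    show "integrable M (\<lambda>z. t / 2 * (cmod (u z))\<^sup>2 + 1 / (2 * t) * (cmod (q z))\<^sup>2)"
      using L2_square[OF u] q2 by (intro Bochner_Integration.integrable_add integrable_mult_right)
    show "cmod (u z * q z) \<le> t / 2 * (cmod (u z))\<^sup>2 + 1 / (2 * t) * (cmod (q z))\<^sup>2" for z
      using sum_squares_bound[of "t * cmod (u z)" "cmod (q z)"] t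
      by (simp add: norm_mult field_simps power2_eq_square)
  qed
  also have "\<dots> = t / 2 * (\<integral>z. (cmod (u z))\<^sup>2 \<partial>M) + 1 / (2 * t) * (\<integral>z. (cmod (q z))\<^sup>2 \<partial>M)"
    using L2_square[OF u] q2
    by (subst Bochner_Integration.integral_add) (auto simp only: integrable_mult_right integral_mult_right_zero)
  finally show ?thesis .
qed

lemma integral_le_rectangle:
  fixes F H :: "real \<times> real \<Rightarrow> real"
  assumes F: "continuous_on UNIV F" and H: "continuous_on R H" "\<And>z. z \<in> R \<Longrightarrow> 0 \<le> H z"
    and zero: "\<And>z. z \<in> \<Omega> - R \<Longrightarrow> F z \<le> 0" and le: "\<And>z. z \<in> \<Omega> \<inter> R \<Longrightarrow> F z \<le> H z"
  shows "(\<integral>z. F z \<partial>M) \<le> integral R H"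
proof -
  have "(\<integral>z. F z \<partial>M) = (\<integral>z. indicator \<Omega> z *\<^sub>R F z \<partial>lebesgue)"
    by (intro integral_restrict_space) simp
  also have "\<dots> \<le> (\<integral>z. indicator R z *\<^sub>R H z \<partial>lebesgue)"
  proof (rule integral_mono)
    show "integrable lebesgue (\<lambda>z. indicator \<Omega> z *\<^sub>R F z)"
      by (subst integrable_restrict_space[symmetric]) (auto intro: integrable_continuous_\<Omega> F)
    show "integrable lebesgue (\<lambda>z. indicator R z *\<^sub>R H z)"
      by (subst integrable_restrict_space[symmetric]) (auto intro: continuous_imp_integrable H)
    show "indicator \<Omega> z *\<^sub>R F z \<le> indicator R z *\<^sub>R H z" for z
      using H(2) zero le by (auto simp: indicator_def)
  qed
  also have "\<dots> = (\<integral>z. H z \<partial>lebesgue_on R)"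
    by (intro integral_restrict_space[symmetric]) simp
  also have "\<dots> = integral R H"
    by (intro lebesgue_integral_eq_integral continuous_imp_integrable H) simp
  finally show ?thesis .
qed

section \<open>Estimates uniform in the spectral parameter\<close>

definition freq :: "nat \<Rightarrow> real" where "freq k = real k * pi / a"

text \<open>Solved mode by mode. A pointwise bound by \<open>c * ?J k\<close> gives a squared norm
  of at most \<open>L * (c * ?J k)\<^sup>2\<close>, hence \<open>c\<^sup>2 * L\<^sup>2\<close> times
  that of \<open>p k\<close>; here \<open>c\<close> is \<open>3 / 2\<close> for
  \<open>\<psi>'\<close> and \<open>3 / 2 * L\<close> for \<open>\<psi>\<close>. Parseval adds this
  up, and no constant involves \<open>\<mu>\<close>.\<close>

lemma mode_resolvent:
  assumes I: "finite I" "\<And>k. k \<in> I \<Longrightarrow> 1 \<le> k" and p: "\<And>k. k \<in> I \<Longrightarrow> smooth1 (p k)"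
  obtains \<psi> \<psi>' where
    "\<And>k x. k \<in> I \<Longrightarrow> (\<psi> k has_vector_derivative \<psi>' k x) (at x)"
    "\<And>k x. k \<in> I \<Longrightarrow> (\<psi>' k has_vector_derivative - of_real (\<mu> k) * \<psi> k x - p k x) (at x)"
    "\<And>k. k \<in> I \<Longrightarrow> smooth1 (\<psi> k)"
    "integral R (\<lambda>z. (cmod (mode_sum a I \<psi> z))\<^sup>2) \<le> 9 / 4 * L ^ 4 * integral R (\<lambda>z. (cmod (mode_sum a I p z))\<^sup>2)"
    "integral R (\<lambda>z. (cmod (mode_sum a I \<psi>' z))\<^sup>2) \<le> 9 / 4 * L ^ 2 * integral R (\<lambda>z. (cmod (mode_sum a I p z))\<^sup>2)"
proof -
  let ?J = "\<lambda>k. integral {0..L} (\<lambda>t. norm (p k t))"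
  define Q where "Q k \<psi> \<psi>' \<longleftrightarrow> (\<forall>x. (\<psi> has_vector_derivative \<psi>' x) (at x)) \<and>
    (\<forall>x. (\<psi>' has_vector_derivative - of_real (\<mu> k) * \<psi> x - p k x) (at x)) \<and> smooth1 \<psi> \<and>
    (\<forall>x\<in>{0..L}. norm (\<psi>' x) \<le> 3 / 2 * ?J k) \<and> (\<forall>x\<in>{0..L}. norm (\<psi> x) \<le> L * (3 / 2 * ?J k))"
    for k \<psi> \<psi>'
  have "\<forall>k\<in>I. \<exists>w. Q k (fst w) (snd w)"
  proof
    fix k assume k: "k \<in> I"
    obtain \<psi> \<psi>' where "\<And>x. (\<psi> has_vector_derivative \<psi>' x) (at x)"
      "\<And>x. (\<psi>' has_vector_derivative - of_real (\<mu> k) * \<psi> x - p k x) (at x)" "smooth1 \<psi>"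
      "\<And>x. x \<in> {0..L} \<Longrightarrow> norm (\<psi>' x) \<le> 3 / 2 * ?J k"
      "\<And>x. x \<in> {0..L} \<Longrightarrow> norm (\<psi> x) \<le> L * (3 / 2 * ?J k)"
      by (rule helmholtz_1d_solution[OF p[OF k] L, of "\<mu> k"]) (rule that; assumption)
    then show "\<exists>w. Q k (fst w) (snd w)"
      unfolding Q_def by (intro exI[of _ "(\<psi>, \<psi>')"]) simp
  qed
  from bchoice[OF this] obtain w where w: "\<forall>k\<in>I. Q k (fst (w k)) (snd (w k))" ..
  define \<psi> \<psi>' where "\<psi> k = fst (w k)" and "\<psi>' k = snd (w k)" for k
  have Q: "Q k (\<psi> k) (\<psi>' k)" if "k \<in> I" for k using w that by (simp add: \<psi>_def \<psi>'_def)
  have 1: "(\<psi> k has_vector_derivative \<psi>' k x) (at x)"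
    and 2: "(\<psi>' k has_vector_derivative - of_real (\<mu> k) * \<psi> k x - p k x) (at x)"
    and 3: "smooth1 (\<psi> k)" if "k \<in> I" for k x
    using Q[OF that] unfolding Q_def by blast+
  have 4: "norm (\<psi>' k x) \<le> 3 / 2 * ?J k" and 5: "norm (\<psi> k x) \<le> L * (3 / 2 * ?J k)"
    if "k \<in> I" "x \<in> {0..L}" for k x
    using Q[OF that(1)] that(2) unfolding Q_def by blast+
  have pc: "continuous_on S (p k)" if "k \<in> I" for k S using p[OF that] by (rule smooth1_continuous)
  have c: "continuous_on S (\<psi> k)" "continuous_on S (\<psi>' k)" if "k \<in> I" for k S
    by (rule continuous_on_vector_derivative[OF 1[OF that]], rule continuous_on_vector_derivative[OF 2[OF that]])
  have J: "(?J k)\<^sup>2 \<le> L * integral {0..L} (\<lambda>x. (cmod (p k x))\<^sup>2)" if "k \<in> I" for k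
    by (rule square_integral_le) (use L in \<open>auto intro!: continuous_intros pc that\<close>)
  have sq: "integral {0..L} (\<lambda>x. (cmod (u x))\<^sup>2) \<le> L * (c * ?J k)\<^sup>2"
    if "continuous_on {0..L} u" "\<And>x. x \<in> {0..L} \<Longrightarrow> cmod (u x) \<le> c * ?J k" for u k c
  proof -
    have "integral {0..L} (\<lambda>x. (cmod (u x))\<^sup>2) \<le> integral {0..L} (\<lambda>x. (c * ?J k)\<^sup>2)"
      by (intro integral_le power_mono that(2))
        (auto intro!: integrable_continuous_interval continuous_intros that(1))
    then show ?thesis using L by simp
  qed
  have sum_le: "integral R (\<lambda>z. (cmod (mode_sum a I q z))\<^sup>2) \<le> c\<^sup>2 * L\<^sup>2 * integral R (\<lambda>z. (cmod (mode_sum a I p z))\<^sup>2)"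
    if "\<And>k. k \<in> I \<Longrightarrow> continuous_on UNIV (q k)" "\<And>k x. k \<in> I \<Longrightarrow> x \<in> {0..L} \<Longrightarrow> cmod (q k x) \<le> c * ?J k" for q c
  proof -
    have "integral {0..L} (\<lambda>x. (cmod (q k x))\<^sup>2) \<le> c\<^sup>2 * L\<^sup>2 * integral {0..L} (\<lambda>x. (cmod (p k x))\<^sup>2)"
      if k: "k \<in> I" for k
    proof -
      have "integral {0..L} (\<lambda>x. (cmod (q k x))\<^sup>2) \<le> L * (c * ?J k)\<^sup>2"
        by (rule sq) (use that \<open>\<And>k. k \<in> I \<Longrightarrow> continuous_on UNIV (q k)\<close>
          \<open>\<And>k x. k \<in> I \<Longrightarrow> x \<in> {0..L} \<Longrightarrow> cmod (q k x) \<le> c * ?J k\<close> in \<open>auto intro: continuous_on_subset\<close>)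
      also have "\<dots> = (c\<^sup>2 * L) * (?J k)\<^sup>2" by (simp add: power_mult_distrib)
      also have "\<dots> \<le> (c\<^sup>2 * L) * (L * integral {0..L} (\<lambda>x. (cmod (p k x))\<^sup>2))"
        using L by (intro mult_left_mono J k) auto
      finally show ?thesis by (simp add: power2_eq_square mult_ac)
    qed
    then have "(\<Sum>k\<in>I. integral {0..L} (\<lambda>x. (cmod (q k x))\<^sup>2)) \<le> (\<Sum>k\<in>I. c\<^sup>2 * L\<^sup>2 * integral {0..L} (\<lambda>x. (cmod (p k x))\<^sup>2))"
      by (rule sum_mono)
    then have "a / 2 * (\<Sum>k\<in>I. integral {0..L} (\<lambda>x. (cmod (q k x))\<^sup>2))
        \<le> a / 2 * (c\<^sup>2 * L\<^sup>2 * (\<Sum>k\<in>I. integral {0..L} (\<lambda>x. (cmod (p k x))\<^sup>2)))"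
      unfolding sum_distrib_left[symmetric] using a by (intro mult_left_mono) auto
    moreover have "integral R (\<lambda>z. (cmod (mode_sum a I q z))\<^sup>2) = a / 2 * (\<Sum>k\<in>I. integral {0..L} (\<lambda>x. (cmod (q k x))\<^sup>2))"
      by (rule mode_parseval[OF a L I that(1)])
    moreover have "integral R (\<lambda>z. (cmod (mode_sum a I p z))\<^sup>2) = a / 2 * (\<Sum>k\<in>I. integral {0..L} (\<lambda>x. (cmod (p k x))\<^sup>2))"
      by (rule mode_parseval[OF a L I pc])
    ultimately show ?thesis by (simp only: mult_ac)
  qed
  have "integral R (\<lambda>z. (cmod (mode_sum a I \<psi> z))\<^sup>2) \<le> (3 / 2 * L)\<^sup>2 * L\<^sup>2 * integral R (\<lambda>z. (cmod (mode_sum a I p z))\<^sup>2)"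
    by (rule sum_le) (use c 5 in \<open>auto simp: mult_ac\<close>)
  moreover have "(3 / 2 * L)\<^sup>2 * L\<^sup>2 = 9 / 4 * L ^ 4"
    by (simp add: power_mult_distrib power2_eq_square power4_eq_xxxx)
  moreover have "integral R (\<lambda>z. (cmod (mode_sum a I \<psi>' z))\<^sup>2) \<le> (3 / 2)\<^sup>2 * L\<^sup>2 * integral R (\<lambda>z. (cmod (mode_sum a I p z))\<^sup>2)"
    by (rule sum_le) (use c 4 in auto)
  moreover have "((3::real) / 2)\<^sup>2 = 9 / 4" by (simp add: power2_eq_square)
  ultimately show ?thesis
    by (intro that[of \<psi> \<psi>', OF 1 2 3]) (simp_all only:)
qed

text \<open>Each mode is tested with \<open>\<eta> * \<psi> n\<close>. By the equation for
  \<open>\<psi> n\<close>, the second derivative of this product plus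
  \<open>(k\<^sup>2 - (freq n)\<^sup>2)\<close> times it is
  \<open>\<eta>'' * \<psi> n + 2 * \<eta>' * \<psi>' n - \<eta> * p n\<close>: the spectral
  parameter is gone and only the commutator with \<eta> remains.\<close>

lemma mode_sum_identity:
  assumes v: "v \<in> H10 \<Omega>" and f: "f \<in> L2 \<Omega>" and eq: "helmholtz_distributional \<Omega> k v f"
    and \<eta>: "smooth1 \<eta>" "\<And>x. (\<eta> has_vector_derivative \<eta>' x) (at x)" "\<And>x. (\<eta>' has_vector_derivative \<eta>'' x) (at x)"
    and supp: "0 < l" "r < L" "\<And>x. x \<notin> {l..r} \<Longrightarrow> \<eta> x = 0"
    and I: "finite I" "\<And>n. n \<in> I \<Longrightarrow> 1 \<le> n"
    and p: "\<And>n. n \<in> I \<Longrightarrow> smooth1 (p n)"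
    and \<psi>: "\<And>n x. n \<in> I \<Longrightarrow> (\<psi> n has_vector_derivative \<psi>' n x) (at x)"
      "\<And>n x. n \<in> I \<Longrightarrow> (\<psi>' n has_vector_derivative - of_real (k\<^sup>2 - (freq n)\<^sup>2) * \<psi> n x - p n x) (at x)"
      "\<And>n. n \<in> I \<Longrightarrow> smooth1 (\<psi> n)"
  shows "(\<integral>z. v z * (\<eta> (fst z) * mode_sum a I p z) \<partial>M) = (\<integral>z. f z * (\<eta> (fst z) * mode_sum a I \<psi> z) \<partial>M)
    + (\<integral>z. v z * (\<eta>'' (fst z) * mode_sum a I \<psi> z + 2 * \<eta>' (fst z) * mode_sum a I \<psi>' z) \<partial>M)"
proof -
  have vL: "v \<in> L2 \<Omega>" using v by (auto simp: H10_def)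
  let ?s = "\<lambda>n y. complex_of_real (mode a n y)"
  have \<eta>'s: "smooth1 \<eta>'" by (rule smooth1_deriv[OF \<eta>(1,2)])
  have \<eta>''s: "smooth1 \<eta>''" by (rule smooth1_deriv[OF \<eta>'s \<eta>(3)])
  have \<psi>': "smooth1 (\<psi>' n)" if "n \<in> I" for n
    using smooth1_deriv[OF \<psi>(3) \<psi>(1)] that by blast
  have ss: "smooth1 (?s n)" for n unfolding mode_def by (rule smooth1_sin)
  have int: "integrable M (\<lambda>z. u z * tensor A (?s n) z)" if "u \<in> L2 \<Omega>" "smooth1 A" for u A n
    by (intro L2_mult_integrable continuous_on_tensor that(1) smooth1_continuous that(2) ss)
  define w where "w n x = \<eta>'' x * \<psi> n x + 2 * \<eta>' x * \<psi>' n x" for n x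
  have ws: "smooth1 (w n)" if "n \<in> I" for n
    unfolding w_def[abs_def]
    by (intro smooth1_add smooth1_mult smooth1_const \<eta>'s \<eta>''s \<psi> \<psi>' that)
  have one: "(\<integral>z. v z * tensor (\<lambda>x. \<eta> x * p n x) (?s n) z \<partial>M)
      = (\<integral>z. f z * tensor (\<lambda>x. \<eta> x * \<psi> n x) (?s n) z \<partial>M) + (\<integral>z. v z * tensor (w n) (?s n) z \<partial>M)"
    if n: "n \<in> I" for n
  proof -
    have "freq n > 0" using I(2)[OF n] a by (auto simp: freq_def)
    have sin0: "sin (freq n * a) = 0" using a by (simp add: freq_def)
    let ?\<mu> = "complex_of_real (k\<^sup>2 - (freq n)\<^sup>2)"
    let ?\<theta>' = "\<lambda>x. \<eta> x * \<psi>' n x + \<eta>' x * \<psi> n x"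
    let ?\<theta>'' = "\<lambda>x. (\<eta> x * (- ?\<mu> * \<psi> n x - p n x) + \<eta>' x * \<psi>' n x) + (\<eta>' x * \<psi>' n x + \<eta>'' x * \<psi> n x)"
    have "(\<integral>z. v z * (tensor ?\<theta>'' (\<lambda>y. of_real (sin (freq n * y))) z
        + ?\<mu> * tensor (\<lambda>x. \<eta> x * \<psi> n x) (\<lambda>y. of_real (sin (freq n * y))) z) \<partial>M)
      = - (\<integral>z. f z * tensor (\<lambda>x. \<eta> x * \<psi> n x) (\<lambda>y. of_real (sin (freq n * y))) z \<partial>M)"
    proof (rule mode_identity[OF v f eq _ _ _ supp(1,2) _ \<open>freq n > 0\<close> sin0])
      show "smooth1 (\<lambda>x. \<eta> x * \<psi> n x)" using \<eta>(1) \<psi>(3)[OF n] by auto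
      show "((\<lambda>x. \<eta> x * \<psi> n x) has_vector_derivative ?\<theta>' x) (at x)" for x
        by (intro has_vector_derivative_mult \<eta> \<psi> n)
      show "(?\<theta>' has_vector_derivative ?\<theta>'' x) (at x)" for x
        by (intro has_vector_derivative_add has_vector_derivative_mult \<eta> \<psi> n)
      show "\<eta> x * \<psi> n x = 0" if "x \<notin> {l..r}" for x using supp(3)[OF that] by simp
    qed
    moreover have "(\<lambda>y. complex_of_real (sin (freq n * y))) = ?s n"
      by (simp add: mode_def freq_def)
    ultimately have "(\<integral>z. v z * (tensor ?\<theta>'' (?s n) z + ?\<mu> * tensor (\<lambda>x. \<eta> x * \<psi> n x) (?s n) z) \<partial>M)
      = - (\<integral>z. f z * tensor (\<lambda>x. \<eta> x * \<psi> n x) (?s n) z \<partial>M)" by (simp only:)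
    moreover have "v z * (tensor ?\<theta>'' (?s n) z + ?\<mu> * tensor (\<lambda>x. \<eta> x * \<psi> n x) (?s n) z)
      = v z * tensor (w n) (?s n) z - v z * tensor (\<lambda>x. \<eta> x * p n x) (?s n) z" for z
      by (simp add: tensor_def w_def algebra_simps)
    moreover have "(\<integral>z. v z * tensor (w n) (?s n) z - v z * tensor (\<lambda>x. \<eta> x * p n x) (?s n) z \<partial>M)
      = (\<integral>z. v z * tensor (w n) (?s n) z \<partial>M) - (\<integral>z. v z * tensor (\<lambda>x. \<eta> x * p n x) (?s n) z \<partial>M)"
      using n by (intro Bochner_Integration.integral_diff int vL ws smooth1_mult \<eta>(1) p)
    ultimately have "(\<integral>z. v z * tensor (w n) (?s n) z \<partial>M) - (\<integral>z. v z * tensor (\<lambda>x. \<eta> x * p n x) (?s n) z \<partial>M)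
      = - (\<integral>z. f z * tensor (\<lambda>x. \<eta> x * \<psi> n x) (?s n) z \<partial>M)" by (simp only:)
    then show ?thesis by (simp add: algebra_simps)
  qed
  have "(\<integral>z. v z * (\<eta> (fst z) * mode_sum a I p z) \<partial>M)
      = (\<integral>z. (\<Sum>n\<in>I. v z * tensor (\<lambda>x. \<eta> x * p n x) (?s n) z) \<partial>M)"
    by (simp add: mode_sum_def tensor_def sum_distrib_left mult_ac)
  also have "\<dots> = (\<Sum>n\<in>I. \<integral>z. v z * tensor (\<lambda>x. \<eta> x * p n x) (?s n) z \<partial>M)"
    by (intro Bochner_Integration.integral_sum int vL smooth1_mult \<eta>(1) p)
  also have "\<dots> = (\<Sum>n\<in>I. \<integral>z. f z * tensor (\<lambda>x. \<eta> x * \<psi> n x) (?s n) z \<partial>M)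
      + (\<Sum>n\<in>I. \<integral>z. v z * tensor (w n) (?s n) z \<partial>M)"
    by (simp add: one sum.distrib)
  also have "(\<Sum>n\<in>I. \<integral>z. f z * tensor (\<lambda>x. \<eta> x * \<psi> n x) (?s n) z \<partial>M)
      = (\<integral>z. (\<Sum>n\<in>I. f z * tensor (\<lambda>x. \<eta> x * \<psi> n x) (?s n) z) \<partial>M)"
    by (intro Bochner_Integration.integral_sum[symmetric] int f smooth1_mult \<eta>(1) \<psi>)
  also have "\<dots> = (\<integral>z. f z * (\<eta> (fst z) * mode_sum a I \<psi> z) \<partial>M)"
    by (simp add: mode_sum_def tensor_def sum_distrib_left mult_ac)
  also have "(\<Sum>n\<in>I. \<integral>z. v z * tensor (w n) (?s n) z \<partial>M)
      = (\<integral>z. (\<Sum>n\<in>I. v z * tensor (w n) (?s n) z) \<partial>M)"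
    by (intro Bochner_Integration.integral_sum[symmetric] int vL ws)
  also have "\<dots> = (\<integral>z. v z * (\<eta>'' (fst z) * mode_sum a I \<psi> z + 2 * \<eta>' (fst z) * mode_sum a I \<psi>' z) \<partial>M)"
    by (intro Bochner_Integration.integral_cong refl)
      (simp add: mode_sum_def tensor_def w_def sum_distrib_left sum.distrib[symmetric] algebra_simps)
  finally show ?thesis .
qed

text \<open>Truncation by an indicator keeps integrals over a part of \<Omega> on the single measure
  \<open>M\<close>, so that the pairing estimates apply to them.\<close>

lemma L2_restrict:
  assumes u: "u \<in> L2 \<Omega>" and S: "S \<in> sets lebesgue"
  shows "(\<lambda>z. indicator S z * u z) \<in> L2 \<Omega>"
    and "(\<integral>z. (cmod (indicator S z * u z))\<^sup>2 \<partial>M) = (\<integral>z. (cmod (u z))\<^sup>2 \<partial>lebesgue_on (\<Omega> \<inter> S))"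
proof -
  have m: "(\<lambda>z. indicator S z * u z) \<in> borel_measurable M"
  proof -
    have "(indicator S :: _ \<Rightarrow> complex) \<in> borel_measurable lebesgue" using S by simp
    then have "(indicator S :: _ \<Rightarrow> complex) \<in> borel_measurable M"
      by (rule measurable_restrict_space1)
    then show ?thesis using L2_measurable[OF u] by (rule borel_measurable_times)
  qed
  have le: "(cmod (indicator S z * u z))\<^sup>2 \<le> (cmod (u z))\<^sup>2" for z
    by (auto simp: indicator_def)
  have "integrable M (\<lambda>z. (cmod (indicator S z * u z))\<^sup>2)"
    by (rule Bochner_Integration.integrable_bound[OF L2_square[OF u]])
      (use m le in \<open>auto intro!: AE_I2 borel_measurable_power borel_measurable_norm\<close>)
  with m show "(\<lambda>z. indicator S z * u z) \<in> L2 \<Omega>" by (simp add: L2_def)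
  have "(\<integral>z. (cmod (indicator S z * u z))\<^sup>2 \<partial>M) = (\<integral>z. indicator \<Omega> z *\<^sub>R (cmod (indicator S z * u z))\<^sup>2 \<partial>lebesgue)"
    by (intro integral_restrict_space) simp
  also have "\<dots> = (\<integral>z. indicator (\<Omega> \<inter> S) z *\<^sub>R (cmod (u z))\<^sup>2 \<partial>lebesgue)"
    by (intro Bochner_Integration.integral_cong) (auto simp: indicator_def)
  also have "\<dots> = (\<integral>z. (cmod (u z))\<^sup>2 \<partial>lebesgue_on (\<Omega> \<inter> S))"
    by (intro integral_restrict_space[symmetric]) (use sets.Int[OF sets_\<Omega> S] in simp)
  finally show "(\<integral>z. (cmod (indicator S z * u z))\<^sup>2 \<partial>M) = (\<integral>z. (cmod (u z))\<^sup>2 \<partial>lebesgue_on (\<Omega> \<inter> S))" .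
qed

text \<open>\<open>C\<close> and \<eta> are fixed before \<open>k\<close>, \<open>v\<close>,
  \<open>f\<close> and \<open>g\<close>. The term with \<open>f\<close> is estimated on all of
  \<Omega>, while the commutator meets \<open>v\<close> only off the inner rectangle.\<close>

lemma mode_sum_bound:
  assumes \<alpha>\<beta>: "0 < \<alpha>" "\<alpha> < \<beta>" "\<beta> < L"
  obtains \<eta> :: "real \<Rightarrow> real" and C where "C \<ge> 0" "continuous_on UNIV \<eta>"
    "\<And>x. 0 \<le> \<eta> x" "\<And>x. \<eta> x \<le> 1" "\<And>x. x \<notin> {0..L} \<Longrightarrow> \<eta> x = 0" "\<And>x. x \<in> {\<alpha>..\<beta>} \<Longrightarrow> \<eta> x = 1"
    "\<And>k v f g. v \<in> H10 \<Omega> \<Longrightarrow> f \<in> L2 \<Omega> \<Longrightarrow> helmholtz_distributional \<Omega> k v f \<Longrightarrow> g \<in> mode_span a \<Longrightarrow>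
      cmod (\<integral>z. v z * (of_real (\<eta> (fst z)) * g z) \<partial>M)
        \<le> C * ((\<integral>z. (cmod (f z))\<^sup>2 \<partial>M) + (\<integral>z. (cmod (v z))\<^sup>2 \<partial>lebesgue_on (\<Omega> - {\<alpha>..\<beta>} \<times> {0..a})))
          + 1 / 16 * integral R (\<lambda>z. (cmod (g z))\<^sup>2)"
proof -
  obtain \<eta> l r U where \<eta>: "smooth1 (\<lambda>x. of_real (\<eta> x))" "0 < l" "l < r" "r < L"
    "\<And>x. x \<notin> {l..r} \<Longrightarrow> \<eta> x = 0" "open U" "{\<alpha>..\<beta>} \<subseteq> U" "\<And>x. x \<in> U \<Longrightarrow> \<eta> x = 1"
    "\<And>x. 0 \<le> \<eta> x" "\<And>x. \<eta> x \<le> 1"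
    using plateau_exists[OF \<alpha>\<beta>] by blast
  define e where "e x = complex_of_real (\<eta> x)" for x
  have e: "smooth1 e" using \<eta>(1) by (simp add: e_def[abs_def])
  obtain e' where e': "\<And>x. (e has_vector_derivative e' x) (at x)" "smooth1 e'" using smooth1E[OF e] by blast
  obtain e'' where e'': "\<And>x. (e' has_vector_derivative e'' x) (at x)" "smooth1 e''" using smooth1E[OF e'(2)] by blast
  have flat': "e' x = 0" if "x \<in> U" for x
    by (rule vector_derivative_locally_constant[OF e'(1) \<eta>(6) that, of 1]) (simp add: e_def \<eta>(8))
  have flat'': "e'' x = 0" if "x \<in> U" for x
    by (rule vector_derivative_locally_constant[OF e''(1) \<eta>(6) that flat'])
  have off: "e x = 0" "e' x = 0" "e'' x = 0" if "x \<notin> {0..L}" for x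
  proof -
    have V: "open (- {l..r})" "x \<in> - {l..r}" using that \<eta>(2,4) by auto
    have z: "y \<in> - {l..r} \<Longrightarrow> e y = 0" for y using \<eta>(5) by (simp add: e_def)
    have z': "y \<in> - {l..r} \<Longrightarrow> e' y = 0" for y
      by (rule vector_derivative_locally_constant[OF e'(1) V(1) _ z])
    show "e x = 0" "e' x = 0" using z z' V by auto
    show "e'' x = 0" by (rule vector_derivative_locally_constant[OF e''(1) V z'])
  qed
  \<comment> \<open>All these functions vanish off \<open>{0..L}\<close>, so compactness of that
    interval gives a global bound.\<close>
  obtain B where B: "B \<ge> 0" "\<And>x. cmod (e x) \<le> B" "\<And>x. cmod (2 * e' x) \<le> B" "\<And>x. cmod (e'' x) \<le> B"
  proof -
    have "bounded (u ` {0..L})" if "smooth1 u" for u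
      by (intro compact_imp_bounded compact_continuous_image smooth1_continuous[OF that]) auto
    then have "bounded (e ` {0..L} \<union> (\<lambda>x. 2 * e' x) ` {0..L} \<union> e'' ` {0..L})"
      using e e'(2) e''(2) smooth1_mult[OF smooth1_const e'(2), of 2] by auto
    then obtain B where B: "\<And>w. w \<in> e ` {0..L} \<union> (\<lambda>x. 2 * e' x) ` {0..L} \<union> e'' ` {0..L} \<Longrightarrow> cmod w \<le> B"
      unfolding bounded_iff by blast
    have "cmod (e x) \<le> \<bar>B\<bar>" "cmod (2 * e' x) \<le> \<bar>B\<bar>" "cmod (e'' x) \<le> \<bar>B\<bar>" for x
    proof (atomize (full), cases "x \<in> {0..L}")
      case True
      then show "cmod (e x) \<le> \<bar>B\<bar> \<and> cmod (2 * e' x) \<le> \<bar>B\<bar> \<and> cmod (e'' x) \<le> \<bar>B\<bar>"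
        using B[of "e x"] B[of "2 * e' x"] B[of "e'' x"] abs_ge_self[of B]
        by (meson UnI1 UnI2 image_eqI order_trans)
    qed (use off in auto)
    then show ?thesis using that[of "\<bar>B\<bar>"] by auto
  qed
  \<comment> \<open>Young's inequality with weight \<open>8 D\<close> turns the factor \<open>D\<close> of \<open>\<integral>|g|\<^sup>2\<close> into \<open>1/16\<close>.\<close>
  define D where "D = B\<^sup>2 * (27 / 4 * L ^ 4 + 18 / 4 * L\<^sup>2) + 1"
  have D: "D > 0" unfolding D_def by (intro add_nonneg_pos mult_nonneg_nonneg add_nonneg_nonneg) auto
  define S where "S = - ({\<alpha>..\<beta>} \<times> {0..a})"
  have "open S" unfolding S_def by (intro open_Compl closed_Times closed_atLeastAtMost)
  then have S: "S \<in> sets lebesgue" by auto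
  show ?thesis
  proof (rule that[of "4 * D" \<eta>])
    show "continuous_on UNIV \<eta>"
      using continuous_on_Re[OF smooth1_continuous[OF \<eta>(1)], of UNIV] by simp
    show "\<eta> x = 0" if "x \<notin> {0..L}" for x using off(1)[OF that] by (simp add: e_def)
    show "\<eta> x = 1" if "x \<in> {\<alpha>..\<beta>}" for x using \<eta>(7,8) that by blast
    show "0 \<le> 4 * D" using D by simp
  next
    fix k v f g
    assume v: "v \<in> H10 \<Omega>" and f: "f \<in> L2 \<Omega>" and eq: "helmholtz_distributional \<Omega> k v f" and g: "g \<in> mode_span a"
    have vL: "v \<in> L2 \<Omega>" using v by (auto simp: H10_def)
    obtain I p where I: "finite I" "\<And>n. n \<in> I \<Longrightarrow> 1 \<le> n" "\<And>n. n \<in> I \<Longrightarrow> smooth1 (p n)" and gI: "g = mode_sum a I p"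
      using g unfolding mode_span_def by auto
    define G where "G = integral R (\<lambda>z. (cmod (g z))\<^sup>2)"
    let ?G = "integral R (\<lambda>z. (cmod (mode_sum a I p z))\<^sup>2)"
    obtain \<psi> \<psi>' where \<psi>_unfolded:
      "\<And>n x. n \<in> I \<Longrightarrow> (\<psi> n has_vector_derivative \<psi>' n x) (at x)"
      "\<And>n x. n \<in> I \<Longrightarrow> (\<psi>' n has_vector_derivative - of_real (k\<^sup>2 - (freq n)\<^sup>2) * \<psi> n x - p n x) (at x)"
      "\<And>n. n \<in> I \<Longrightarrow> smooth1 (\<psi> n)"
      "integral R (\<lambda>z. (cmod (mode_sum a I \<psi> z))\<^sup>2) \<le> 9 / 4 * L ^ 4 * ?G"
      "integral R (\<lambda>z. (cmod (mode_sum a I \<psi>' z))\<^sup>2) \<le> 9 / 4 * L ^ 2 * ?G"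
      by (rule mode_resolvent[where \<mu>="\<lambda>n. k\<^sup>2 - (freq n)\<^sup>2", OF I]) (assumption | rule that; assumption)+
    note \<psi> = \<psi>_unfolded[folded gI, folded G_def]
    define P P' where "P = mode_sum a I \<psi>" and "P' = mode_sum a I \<psi>'"
    have Pc: "continuous_on X P" "continuous_on X P'" for X
      unfolding P_def P'_def
      by (intro continuous_on_mode_sum continuous_on_vector_derivative; use \<psi> in blast)+
    have fc: "continuous_on UNIV (\<lambda>z :: real \<times> real. u (fst z))" if "smooth1 u" for u
      using continuous_on_tensor[OF smooth1_continuous[OF that] continuous_on_const, of UNIV 1]
      by (simp add: tensor_def[abs_def])
    define q1 q2 where "q1 z = e (fst z) * P z" and "q2 z = e'' (fst z) * P z + 2 * e' (fst z) * P' z" for z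
    have q: "continuous_on UNIV q1" "continuous_on UNIV q2"
      unfolding q1_def[abs_def] q2_def[abs_def]
      by (intro continuous_intros fc e e'(2) e''(2) Pc)+
    have q_off: "q1 z = 0" "q2 z = 0" if "z \<in> \<Omega> - R" for z
    proof -
      have "fst z \<notin> {0..L}" using that strip by (cases z) auto
      then show "q1 z = 0" "q2 z = 0" using off by (auto simp: q1_def q2_def)
    qed
    have i: "(\<lambda>z. (cmod (P z))\<^sup>2) integrable_on R" "(\<lambda>z. (cmod (P' z))\<^sup>2) integrable_on R"
      by (auto intro!: integrable_continuous continuous_intros Pc)
    have "(\<integral>z. (cmod (q1 z))\<^sup>2 \<partial>M) \<le> integral R (\<lambda>z. B\<^sup>2 * (cmod (P z))\<^sup>2)"
    proof (rule integral_le_rectangle)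
      show "(cmod (q1 z))\<^sup>2 \<le> B\<^sup>2 * (cmod (P z))\<^sup>2" for z
        unfolding q1_def norm_mult power_mult_distrib by (intro mult_right_mono power_mono B(2)) auto
    qed (use q_off in \<open>auto intro!: continuous_intros q Pc\<close>)
    also have "\<dots> = B\<^sup>2 * integral R (\<lambda>z. (cmod (P z))\<^sup>2)" by simp
    also have "\<dots> \<le> B\<^sup>2 * (9 / 4 * L ^ 4 * G)"
      unfolding P_def using \<psi>(4) by (rule mult_left_mono) simp
    finally have n1: "(\<integral>z. (cmod (q1 z))\<^sup>2 \<partial>M) \<le> B\<^sup>2 * (9 / 4 * L ^ 4 * G)" .
    have "(\<integral>z. (cmod (q2 z))\<^sup>2 \<partial>M) \<le> integral R (\<lambda>z. (2 * B\<^sup>2) * ((cmod (P z))\<^sup>2 + (cmod (P' z))\<^sup>2))"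
    proof (rule integral_le_rectangle)
      show "(cmod (q2 z))\<^sup>2 \<le> (2 * B\<^sup>2) * ((cmod (P z))\<^sup>2 + (cmod (P' z))\<^sup>2)" for z
      proof -
        have "(cmod (q2 z))\<^sup>2 \<le> 2 * (cmod (e'' (fst z) * P z))\<^sup>2 + 2 * (cmod (2 * e' (fst z) * P' z))\<^sup>2"
          unfolding q2_def by (rule norm_add_square_le)
        also have "\<dots> \<le> 2 * (B\<^sup>2 * (cmod (P z))\<^sup>2) + 2 * (B\<^sup>2 * (cmod (P' z))\<^sup>2)"
          unfolding norm_mult[of _ "P z"] norm_mult[of _ "P' z"] power_mult_distrib
          by (intro add_mono mult_left_mono mult_right_mono power_mono B(3,4)) auto
        finally show ?thesis by (simp add: algebra_simps)
      qed
    qed (use q_off in \<open>auto intro!: continuous_intros q Pc\<close>)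
    also have "\<dots> = (2 * B\<^sup>2) * (integral R (\<lambda>z. (cmod (P z))\<^sup>2) + integral R (\<lambda>z. (cmod (P' z))\<^sup>2))"
      using i by (simp add: integral_add)
    also have "\<dots> \<le> (2 * B\<^sup>2) * (9 / 4 * L ^ 4 * G + 9 / 4 * L ^ 2 * G)"
      using \<psi>(4,5) by (intro mult_left_mono add_mono) (auto simp: P_def P'_def)
    finally have n2: "(\<integral>z. (cmod (q2 z))\<^sup>2 \<partial>M) \<le> (2 * B\<^sup>2) * (9 / 4 * L ^ 4 * G + 9 / 4 * L ^ 2 * G)" .
    have G: "G \<ge> 0" unfolding G_def gI
      by (intro integral_nonneg integrable_continuous continuous_intros continuous_on_mode_sum smooth1_continuous I) auto
    have fsupp: "x \<notin> {l..r} \<Longrightarrow> e x = 0" for x using \<eta>(5) by (simp add: e_def)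
    have "(\<integral>z. v z * (e (fst z) * g z) \<partial>M) = (\<integral>z. f z * q1 z \<partial>M) + (\<integral>z. v z * q2 z \<partial>M)"
      unfolding gI q1_def q2_def P_def P'_def
      by (rule mode_sum_identity[OF v f eq e e'(1) e''(1) \<eta>(2,4) fsupp I \<psi>(1-3)])
    \<comment> \<open>Over the inner rectangle \<open>e'\<close> and \<open>e''\<close> vanish,
      hence so does \<open>q2\<close>, and \<open>v\<close> may be replaced by its truncation to
      \<open>S\<close>.\<close>
    also have "(\<integral>z. v z * q2 z \<partial>M) = (\<integral>z. (indicator S z * v z) * q2 z \<partial>M)"
    proof (intro Bochner_Integration.integral_cong refl)
      show "v z * q2 z = indicator S z * v z * q2 z" for z
      proof (cases "z \<in> S")
        case False
        then have "fst z \<in> U" using \<eta>(7) by (auto simp: S_def)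
        then show ?thesis using flat' flat'' by (simp add: q2_def)
      qed auto
    qed
    finally have "cmod (\<integral>z. v z * (e (fst z) * g z) \<partial>M)
        \<le> cmod (\<integral>z. f z * q1 z \<partial>M) + cmod (\<integral>z. (indicator S z * v z) * q2 z \<partial>M)"
      by (simp add: norm_triangle_ineq)
    also have "\<dots> \<le> (8 * D / 2 * (\<integral>z. (cmod (f z))\<^sup>2 \<partial>M) + 1 / (2 * (8 * D)) * (\<integral>z. (cmod (q1 z))\<^sup>2 \<partial>M))
        + (8 * D / 2 * (\<integral>z. (cmod (indicator S z * v z))\<^sup>2 \<partial>M) + 1 / (2 * (8 * D)) * (\<integral>z. (cmod (q2 z))\<^sup>2 \<partial>M))"
      using D by (intro add_mono L2_young f q L2_restrict(1) vL S) auto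
    also have "(\<integral>z. (cmod (indicator S z * v z))\<^sup>2 \<partial>M) = (\<integral>z. (cmod (v z))\<^sup>2 \<partial>lebesgue_on (\<Omega> - {\<alpha>..\<beta>} \<times> {0..a}))"
      using L2_restrict(2)[OF vL S] by (simp add: S_def Diff_eq)
    finally have main: "cmod (\<integral>z. v z * (e (fst z) * g z) \<partial>M)
      \<le> 4 * D * ((\<integral>z. (cmod (f z))\<^sup>2 \<partial>M) + (\<integral>z. (cmod (v z))\<^sup>2 \<partial>lebesgue_on (\<Omega> - {\<alpha>..\<beta>} \<times> {0..a})))
        + ((\<integral>z. (cmod (q1 z))\<^sup>2 \<partial>M) + (\<integral>z. (cmod (q2 z))\<^sup>2 \<partial>M)) / (16 * D)"
      by (simp add: algebra_simps add_divide_distrib)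
    \<comment> \<open>\<open>q1\<close> contributes \<open>9 / 4 * L ^ 4\<close> and
      \<open>q2\<close> twice \<open>9 / 4 * L ^ 4 + 9 / 4 * L\<^sup>2\<close>, each times
      \<open>B\<^sup>2 * G\<close>; their sum is the bracket in \<open>D\<close>, whose extra 1
      keeps it positive.\<close>
    have "(\<integral>z. (cmod (q1 z))\<^sup>2 \<partial>M) + (\<integral>z. (cmod (q2 z))\<^sup>2 \<partial>M) \<le> (D - 1) * G"
      using n1 n2 by (simp add: D_def algebra_simps)
    also have "\<dots> \<le> D * G" using G by (intro mult_right_mono) auto
    finally have "((\<integral>z. (cmod (q1 z))\<^sup>2 \<partial>M) + (\<integral>z. (cmod (q2 z))\<^sup>2 \<partial>M)) / (16 * D) \<le> 1 / 16 * G"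
      using D by (simp add: field_simps)
    with main show "cmod (\<integral>z. v z * (of_real (\<eta> (fst z)) * g z) \<partial>M)
        \<le> 4 * D * ((\<integral>z. (cmod (f z))\<^sup>2 \<partial>M) + (\<integral>z. (cmod (v z))\<^sup>2 \<partial>lebesgue_on (\<Omega> - {\<alpha>..\<beta>} \<times> {0..a})))
          + 1 / 16 * integral R (\<lambda>z. (cmod (g z))\<^sup>2)"
      by (simp only: e_def G_def)
  qed (use \<eta> in auto)
qed

section \<open>From sums of modes to the solution itself\<close>

lemma integral_rectangle_le:
  fixes H :: "real \<times> real \<Rightarrow> real"
  assumes H: "continuous_on UNIV H" "\<And>z. 0 \<le> H z" and zero: "\<And>z. z \<notin> \<Omega> \<Longrightarrow> H z = 0"
  shows "integral R H \<le> (\<integral>z. H z \<partial>M)"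
proof -
  have Hc: "continuous_on R H" using H(1) continuous_on_subset by blast
  have "integral R H = (\<integral>z. H z \<partial>lebesgue_on R)"
    by (intro lebesgue_integral_eq_integral[symmetric] continuous_imp_integrable Hc) simp
  also have "\<dots> = (\<integral>z. indicator R z *\<^sub>R H z \<partial>lebesgue)"
    by (intro integral_restrict_space) simp
  also have "\<dots> \<le> (\<integral>z. indicator \<Omega> z *\<^sub>R H z \<partial>lebesgue)"
  proof (rule integral_mono)
    show "integrable lebesgue (\<lambda>z. indicator \<Omega> z *\<^sub>R H z)"
      by (subst integrable_restrict_space[symmetric]) (auto intro: integrable_continuous_\<Omega> H)
    show "integrable lebesgue (\<lambda>z. indicator R z *\<^sub>R H z)"
      by (subst integrable_restrict_space[symmetric]) (auto intro: continuous_imp_integrable Hc)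
    show "indicator R z *\<^sub>R H z \<le> indicator \<Omega> z *\<^sub>R H z" for z
      using H(2)[of z] zero[of z] by (auto simp: indicator_def)
  qed
  also have "\<dots> = (\<integral>z. H z \<partial>M)"
    by (intro integral_restrict_space[symmetric]) simp
  finally show ?thesis .
qed

text \<open>Uniform approximation of \<open>cnj (\<phi> z)\<close> on the rectangle by sums of modes
  \<open>g\<close>, to which \<open>bound\<close> applies. Up to a small error
  \<open>(cmod (g z))\<^sup>2\<close> is at most \<open>2 * (cmod (\<phi> z))\<^sup>2\<close>, which
  turns 1/16 into 1/8. The conjugate appears because the pairing is bilinear and is meant to
  approximate the squared modulus of \<open>v\<close>.\<close>

lemma test_function_bound:
  assumes v: "v \<in> L2 \<Omega>" and \<phi>: "\<phi> \<in> test_functions \<Omega>"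
    and \<eta>: "continuous_on UNIV \<eta>" "\<And>x. 0 \<le> \<eta> x" "\<And>x. \<eta> x \<le> (1::real)" "\<And>x. x \<notin> {0..L} \<Longrightarrow> \<eta> x = 0"
    and bound: "\<And>g. g \<in> mode_span a \<Longrightarrow> cmod (\<integral>z. v z * (of_real (\<eta> (fst z)) * g z) \<partial>M)
      \<le> N + 1 / 16 * integral R (\<lambda>z. (cmod (g z))\<^sup>2)"
  shows "cmod (\<integral>z. v z * (of_real (\<eta> (fst z)) * cnj (\<phi> z)) \<partial>M) \<le> N + 1 / 8 * integral R (\<lambda>z. (cmod (\<phi> z))\<^sup>2)"
proof (rule field_le_epsilon)
  fix \<epsilon> :: real assume \<epsilon>: "\<epsilon> > 0"
  note \<phi>c = test_function_continuous[OF \<phi>]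
  have \<eta>c: "continuous_on S (\<lambda>z :: real \<times> real. \<eta> (fst z))" for S
    using continuous_on_compose2[OF \<eta>(1), of S fst] by (simp add: continuous_on_fst)
  define m where "m = integral R (\<lambda>z. 1 :: real)"
  have m: "m \<ge> 0" unfolding m_def by (intro integral_nonneg integrable_continuous continuous_intros) auto
  define V where "V = (\<integral>z. cmod (v z) \<partial>M)"
  have V: "V \<ge> 0" by (simp add: V_def)
  \<comment> \<open>\<open>e * V\<close> is the error in the pairing with \<open>v\<close> and
    \<open>e * m / 8\<close> the one in the norm of \<open>g\<close>; \<open>e \<le> 1\<close> gives
    \<open>e\<^sup>2 \<le> e\<close>, and the added 1 keeps the denominator positive.\<close>
  define e where "e = min 1 (\<epsilon> / (V + m / 8 + 1))"
  have e: "0 < e" "e \<le> 1" "e * (V + m / 8) \<le> \<epsilon>"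
  proof -
    have p: "V + m / 8 + 1 > 0" using m V by simp
    show "0 < e" "e \<le> 1" using \<epsilon> p by (auto simp: e_def)
    have "e * (V + m / 8) \<le> \<epsilon> / (V + m / 8 + 1) * (V + m / 8 + 1)"
      using m V p \<epsilon> by (intro mult_mono) (auto simp: e_def)
    then show "e * (V + m / 8) \<le> \<epsilon>" using p by simp
  qed
  have K: "closure {z. \<phi> z \<noteq> 0} \<subseteq> UNIV \<times> {0<..<a}"
    using test_function_compact(2)[OF \<phi>] strip by blast
  have K0: "cnj (\<phi> z) = 0" if "z \<notin> closure {z. \<phi> z \<noteq> 0}" for z
    using that closure_subset[of "{z. \<phi> z \<noteq> 0}"] by auto
  have "continuous_on UNIV (\<lambda>z. cnj (\<phi> z))" by (intro continuous_intros \<phi>c)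
  from mode_span_dense[OF a this test_function_compact(1)[OF \<phi>] K K0 e(1), of L]
  obtain g where g: "g \<in> mode_span a" "\<And>z. z \<in> R \<Longrightarrow> cmod (cnj (\<phi> z) - g z) < e" by blast
  have gc: "continuous_on S g" for S
    using g(1) unfolding mode_span_def by (auto intro!: continuous_on_mode_sum smooth1_continuous)
  let ?w = "\<lambda>z. complex_of_real (\<eta> (fst z))"
  have i1: "integrable M (\<lambda>z. v z * (?w z * g z))"
    by (intro L2_mult_integrable v continuous_intros \<eta>c gc)
  have i2: "integrable M (\<lambda>z. v z * (?w z * (cnj (\<phi> z) - g z)))"
    by (intro L2_mult_integrable v continuous_intros \<eta>c gc \<phi>c)
  have "(\<integral>z. v z * (?w z * cnj (\<phi> z)) \<partial>M)
      = (\<integral>z. v z * (?w z * g z) + v z * (?w z * (cnj (\<phi> z) - g z)) \<partial>M)"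
    by (simp add: algebra_simps)
  also have "\<dots> = (\<integral>z. v z * (?w z * g z) \<partial>M) + (\<integral>z. v z * (?w z * (cnj (\<phi> z) - g z)) \<partial>M)"
    by (rule Bochner_Integration.integral_add[OF i1 i2])
  finally have "cmod (\<integral>z. v z * (?w z * cnj (\<phi> z)) \<partial>M)
      \<le> cmod (\<integral>z. v z * (?w z * g z) \<partial>M) + cmod (\<integral>z. v z * (?w z * (cnj (\<phi> z) - g z)) \<partial>M)"
    by (simp add: norm_triangle_ineq)
  moreover have "cmod (\<integral>z. v z * (?w z * (cnj (\<phi> z) - g z)) \<partial>M) \<le> e * V"
  proof -
    have "cmod (\<integral>z. v z * (?w z * (cnj (\<phi> z) - g z)) \<partial>M) \<le> (\<integral>z. e * cmod (v z) \<partial>M)"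
    proof (rule Bochner_Integration.integral_norm_bound_integral[OF i2])
      show "integrable M (\<lambda>z. e * cmod (v z))" using L2_integrable_norm[OF v] by simp
      fix z assume "z \<in> space M"
      then have z: "z \<in> \<Omega>" by simp
      have "cmod (?w z * (cnj (\<phi> z) - g z)) \<le> e"
      proof (cases "z \<in> R")
        case True
        have "cmod (?w z * (cnj (\<phi> z) - g z)) = \<eta> (fst z) * cmod (cnj (\<phi> z) - g z)"
          using \<eta>(2) by (simp add: norm_mult)
        also have "\<dots> \<le> 1 * e" using g(2)[OF True] \<eta> by (intro mult_mono) auto
        finally show ?thesis by simp
      next
        case False
        then have "fst z \<notin> {0..L}" using z strip by (cases z) auto
        then show ?thesis using \<eta>(4) e(1) by simp
      qed
      then show "cmod (v z * (?w z * (cnj (\<phi> z) - g z))) \<le> e * cmod (v z)"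
        unfolding norm_mult[of "v z"] mult.commute[of e] by (rule mult_left_mono) simp
    qed
    then show ?thesis by (simp add: V_def)
  qed
  moreover have "integral R (\<lambda>z. (cmod (g z))\<^sup>2) \<le> 2 * integral R (\<lambda>z. (cmod (\<phi> z))\<^sup>2) + 2 * (e * m)"
  proof -
    have "integral R (\<lambda>z. (cmod (g z))\<^sup>2) \<le> integral R (\<lambda>z. 2 * (cmod (\<phi> z))\<^sup>2 + 2 * (e * 1))"
    proof (rule integral_le)
      fix z assume z: "z \<in> R"
      have "(cmod (g z))\<^sup>2 = (cmod (cnj (\<phi> z) + - (cnj (\<phi> z) - g z)))\<^sup>2" by simp
      also have "\<dots> \<le> 2 * (cmod (cnj (\<phi> z)))\<^sup>2 + 2 * (cmod (- (cnj (\<phi> z) - g z)))\<^sup>2"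
        by (rule norm_add_square_le)
      also have "\<dots> = 2 * (cmod (\<phi> z))\<^sup>2 + 2 * (cmod (cnj (\<phi> z) - g z))\<^sup>2"
        by (simp only: norm_minus_cancel complex_mod_cnj)
      also have "(cmod (cnj (\<phi> z) - g z))\<^sup>2 \<le> e\<^sup>2"
        using g(2)[OF z] by (intro power_mono) auto
      also have "e\<^sup>2 \<le> e * 1" unfolding power2_eq_square using e by (intro mult_left_mono) auto
      finally show "(cmod (g z))\<^sup>2 \<le> 2 * (cmod (\<phi> z))\<^sup>2 + 2 * (e * 1)" by simp
    qed (auto intro!: integrable_continuous continuous_intros gc \<phi>c)
    also have "\<dots> = integral R (\<lambda>z. 2 * (cmod (\<phi> z))\<^sup>2) + integral R (\<lambda>z. (2 * e) * 1)"
      by (subst integral_add[symmetric]) (auto intro!: integrable_continuous continuous_intros \<phi>c)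
    also have "\<dots> = 2 * integral R (\<lambda>z. (cmod (\<phi> z))\<^sup>2) + 2 * (e * m)"
      unfolding m_def integral_mult_right by simp
    finally show ?thesis .
  qed
  ultimately have "cmod (\<integral>z. v z * (?w z * cnj (\<phi> z)) \<partial>M)
      \<le> N + 1 / 8 * integral R (\<lambda>z. (cmod (\<phi> z))\<^sup>2) + e * (V + m / 8)"
    using bound[OF g(1)] by (simp add: algebra_simps)
  then show "cmod (\<integral>z. v z * (?w z * cnj (\<phi> z)) \<partial>M) \<le> N + 1 / 8 * integral R (\<lambda>z. (cmod (\<phi> z))\<^sup>2) + \<epsilon>"
    using e(3) by linarith
qed

text \<open>Off the inner rectangle the mass of \<open>v\<close> is part of the right-hand side; on
  it \<eta> is 1, and the mass is controlled by pairing \<open>v\<close> with its approximating test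
  functions. Half of the squared norm of \<open>v\<close> reappears and is absorbed.\<close>

lemma control_from_complement_of_rectangle:
  assumes \<alpha>\<beta>: "0 < \<alpha>" "\<alpha> < \<beta>" "\<beta> < L"
  obtains C where "\<And>k v f. v \<in> H10 \<Omega> \<Longrightarrow> f \<in> L2 \<Omega> \<Longrightarrow> helmholtz_distributional \<Omega> k v f \<Longrightarrow>
      (\<integral>z. (cmod (v z))\<^sup>2 \<partial>M)
        \<le> C * ((\<integral>z. (cmod (f z))\<^sup>2 \<partial>M) + (\<integral>z. (cmod (v z))\<^sup>2 \<partial>lebesgue_on (\<Omega> - {\<alpha>..\<beta>} \<times> {0..a})))"
proof -
  obtain \<eta> :: "real \<Rightarrow> real" and C where C: "C \<ge> 0" and \<eta>: "continuous_on UNIV \<eta>"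
    "\<And>x. 0 \<le> \<eta> x" "\<And>x. \<eta> x \<le> 1" "\<And>x. x \<notin> {0..L} \<Longrightarrow> \<eta> x = 0" "\<And>x. x \<in> {\<alpha>..\<beta>} \<Longrightarrow> \<eta> x = 1"
    and bound: "\<And>k v f g. v \<in> H10 \<Omega> \<Longrightarrow> f \<in> L2 \<Omega> \<Longrightarrow> helmholtz_distributional \<Omega> k v f \<Longrightarrow> g \<in> mode_span a \<Longrightarrow>
      cmod (\<integral>z. v z * (of_real (\<eta> (fst z)) * g z) \<partial>M)
        \<le> C * ((\<integral>z. (cmod (f z))\<^sup>2 \<partial>M) + (\<integral>z. (cmod (v z))\<^sup>2 \<partial>lebesgue_on (\<Omega> - {\<alpha>..\<beta>} \<times> {0..a})))
          + 1 / 16 * integral R (\<lambda>z. (cmod (g z))\<^sup>2)"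
    by (rule mode_sum_bound[OF \<alpha>\<beta>]) (rule that; assumption)
  have \<eta>c: "continuous_on S (\<lambda>z :: real \<times> real. \<eta> (fst z))" for S
    using continuous_on_compose2[OF \<eta>(1), of S fst] by (simp add: continuous_on_fst)
  define S where "S = - ({\<alpha>..\<beta>} \<times> {0..a})"
  have "open S" unfolding S_def by (intro open_Compl closed_Times closed_atLeastAtMost)
  then have S: "S \<in> sets lebesgue" by auto
  show ?thesis
  proof (rule that[of "2 * (1 + 2 * C)"])
    fix k v f
    assume v: "v \<in> H10 \<Omega>" and f: "f \<in> L2 \<Omega>" and eq: "helmholtz_distributional \<Omega> k v f"
    define W where "W = (\<integral>z. (cmod (v z))\<^sup>2 \<partial>lebesgue_on (\<Omega> - {\<alpha>..\<beta>} \<times> {0..a}))"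
    define N where "N = (\<integral>z. (cmod (f z))\<^sup>2 \<partial>M) + W"
    define V where "V = (\<integral>z. (cmod (v z))\<^sup>2 \<partial>M)"
    have WN: "W \<le> N" by (simp add: N_def)
    obtain gy \<phi> where vL: "v \<in> L2 \<Omega>" and \<phi>: "\<And>n::nat. \<phi> n \<in> test_functions \<Omega>"
      and lim: "(\<lambda>n. \<integral>z. (cmod (\<phi> n z - v z))\<^sup>2 \<partial>M) \<longlonglongrightarrow> 0"
      using H10E[OF v] by blast
    define d where "d n = (\<integral>z. (cmod (\<phi> n z - v z))\<^sup>2 \<partial>M)" for n
    note \<phi>c = test_function_continuous[OF \<phi>]
    let ?w = "\<lambda>z. complex_of_real (\<eta> (fst z))"
    have id: "integrable M (\<lambda>z. (cmod (\<phi> n z - v z))\<^sup>2)" for n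
      by (intro L2_square L2_diff L2_continuous \<phi>c vL)
    have iv: "integrable M (\<lambda>z. (cmod (v z))\<^sup>2)" by (rule L2_square[OF vL])
    have ip: "integrable M (\<lambda>z. v z * (?w z * cnj (\<phi> n z)))" for n
      by (intro L2_mult_integrable vL continuous_intros \<eta>c \<phi>c)
    have iS: "integrable M (\<lambda>z. (cmod (indicator S z * v z))\<^sup>2)"
      by (rule L2_square[OF L2_restrict(1)[OF vL S]])
    \<comment> \<open>The term \<open>2 * (1 / 8) * (2 * V + 2 * d n)\<close> accounts for
      \<open>1 / 2 * V\<close> and \<open>1 / 2 * d n\<close>; the other \<open>d n\<close> comes
      from the pointwise inequality.\<close>
    have "V \<le> W + 2 * (C * N) + 1 / 2 * V + 3 / 2 * d n" for n
    proof -
      have "V \<le> (\<integral>z. (cmod (indicator S z * v z))\<^sup>2 + (2 * Re (v z * (?w z * cnj (\<phi> n z))) + (cmod (\<phi> n z - v z))\<^sup>2) \<partial>M)"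
        unfolding V_def
      proof (rule integral_mono[OF iv])
        show "integrable M (\<lambda>z. (cmod (indicator S z * v z))\<^sup>2 + (2 * Re (v z * (?w z * cnj (\<phi> n z))) + (cmod (\<phi> n z - v z))\<^sup>2))"
          using iS ip[THEN integrable_Re] id by (intro Bochner_Integration.integrable_add integrable_mult_right)
        fix z
        \<comment> \<open>After expansion, the nonnegative term
          \<open>\<eta> (fst z) * (cmod (\<phi> n z))\<^sup>2\<close> is dropped.\<close>
        have "(cmod (\<phi> n z - v z))\<^sup>2 = (cmod (\<phi> n z))\<^sup>2 + (cmod (v z))\<^sup>2 - 2 * Re (v z * cnj (\<phi> n z))"
          unfolding cmod_power2 by (simp add: power2_eq_square algebra_simps)
        then have "\<eta> (fst z) * (cmod (v z))\<^sup>2 \<le> \<eta> (fst z) * (2 * Re (v z * cnj (\<phi> n z)) + (cmod (\<phi> n z - v z))\<^sup>2)"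
          using \<eta>(2) by (intro mult_left_mono) auto
        also have "\<dots> = 2 * Re (v z * (?w z * cnj (\<phi> n z))) + \<eta> (fst z) * (cmod (\<phi> n z - v z))\<^sup>2"
          by (simp add: algebra_simps)
        also have "\<eta> (fst z) * (cmod (\<phi> n z - v z))\<^sup>2 \<le> 1 * (cmod (\<phi> n z - v z))\<^sup>2"
          using \<eta>(3) by (intro mult_right_mono) auto
        finally have *: "\<eta> (fst z) * (cmod (v z))\<^sup>2 \<le> 2 * Re (v z * (?w z * cnj (\<phi> n z))) + (cmod (\<phi> n z - v z))\<^sup>2" by simp
        show "(cmod (v z))\<^sup>2 \<le> (cmod (indicator S z * v z))\<^sup>2 + (2 * Re (v z * (?w z * cnj (\<phi> n z))) + (cmod (\<phi> n z - v z))\<^sup>2)"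
        proof (cases "z \<in> S")
          case True
          have "0 \<le> \<eta> (fst z) * (cmod (v z))\<^sup>2" using \<eta>(2) by simp
          with * True show ?thesis by simp
        next
          case False
          then have "\<eta> (fst z) = 1" using \<eta>(5) by (auto simp: S_def)
          with * False show ?thesis by simp
        qed
      qed
      also have "\<dots> = (\<integral>z. (cmod (indicator S z * v z))\<^sup>2 \<partial>M)
          + (2 * (\<integral>z. Re (v z * (?w z * cnj (\<phi> n z))) \<partial>M) + d n)"
        unfolding d_def
        using iS ip[THEN integrable_Re] id
        by (subst Bochner_Integration.integral_add, simp, intro Bochner_Integration.integrable_add integrable_mult_right, simp, simp)
          (subst Bochner_Integration.integral_add; simp only: integrable_mult_right integral_mult_right_zero)
      also have "(\<integral>z. (cmod (indicator S z * v z))\<^sup>2 \<partial>M) = W"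
        using L2_restrict(2)[OF vL S] by (simp add: S_def W_def Diff_eq)
      also have "(\<integral>z. Re (v z * (?w z * cnj (\<phi> n z))) \<partial>M) = Re (\<integral>z. v z * (?w z * cnj (\<phi> n z)) \<partial>M)"
        by (rule integral_Re[OF ip])
      also have "\<dots> \<le> cmod (\<integral>z. v z * (?w z * cnj (\<phi> n z)) \<partial>M)"
        by (rule complex_Re_le_cmod)
      also have "\<dots> \<le> C * N + 1 / 8 * integral R (\<lambda>z. (cmod (\<phi> n z))\<^sup>2)"
        unfolding N_def W_def
        by (rule test_function_bound[OF vL \<phi> \<eta>(1-4) bound[OF v f eq]])
      also have "integral R (\<lambda>z. (cmod (\<phi> n z))\<^sup>2) \<le> (\<integral>z. (cmod (\<phi> n z))\<^sup>2 \<partial>M)"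
        using test_function_outside[OF \<phi>] by (intro integral_rectangle_le continuous_intros \<phi>c) auto
      also have "\<dots> \<le> (\<integral>z. 2 * (cmod (v z))\<^sup>2 + 2 * (cmod (\<phi> n z - v z))\<^sup>2 \<partial>M)"
      proof (rule integral_mono)
        show "integrable M (\<lambda>z. (cmod (\<phi> n z))\<^sup>2)" by (intro integrable_continuous_\<Omega> continuous_intros \<phi>c)
        show "integrable M (\<lambda>z. 2 * (cmod (v z))\<^sup>2 + 2 * (cmod (\<phi> n z - v z))\<^sup>2)"
          using iv id by (intro Bochner_Integration.integrable_add integrable_mult_right)
        show "(cmod (\<phi> n z))\<^sup>2 \<le> 2 * (cmod (v z))\<^sup>2 + 2 * (cmod (\<phi> n z - v z))\<^sup>2" for z
          using norm_add_square_le[of "v z" "\<phi> n z - v z"] by simp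
      qed
      also have "\<dots> = 2 * V + 2 * d n"
        unfolding V_def d_def using iv id by (subst Bochner_Integration.integral_add) simp_all
      finally show ?thesis by (simp add: algebra_simps)
    qed
    moreover have "(\<lambda>n. W + 2 * (C * N) + 1 / 2 * V + 3 / 2 * d n) \<longlonglongrightarrow> W + 2 * (C * N) + 1 / 2 * V + 3 / 2 * 0"
      using lim unfolding d_def by (intro tendsto_intros)
    ultimately have "V \<le> W + 2 * (C * N) + 1 / 2 * V + 3 / 2 * 0"
      by (intro LIMSEQ_le_const) auto
    then have "V \<le> 2 * (1 + 2 * C) * N" using WN by (simp add: algebra_simps)
    then show "(\<integral>z. (cmod (v z))\<^sup>2 \<partial>M)
        \<le> 2 * (1 + 2 * C) * ((\<integral>z. (cmod (f z))\<^sup>2 \<partial>M) + (\<integral>z. (cmod (v z))\<^sup>2 \<partial>lebesgue_on (\<Omega> - {\<alpha>..\<beta>} \<times> {0..a})))"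
      by (simp only: V_def N_def W_def)
  qed
qed

end

section \<open>The stadium\<close>

text \<open>The discs have radius \<open>a / 2\<close> and centres at height \<open>a / 2\<close>,
  so the closed union lies in the closed strip; taking interiors gives the open strip.\<close>

lemma stadium_strip_domain:
  assumes "L > 0" "a > 0"
  shows "strip_domain (stadium L a) L a"
proof
  let ?U = "{0..L} \<times> {0..a} \<union> cball (0, a / 2) (a / 2) \<union> cball (L, a / 2) (a / 2) :: (real \<times> real) set"
  show "open (stadium L a)" by (simp add: stadium_def)
  have "bounded ?U" by (intro bounded_Un[THEN iffD2] conjI bounded_Times bounded_cball) auto
  then show "bounded (stadium L a)" unfolding stadium_def by (rule bounded_interior)
  have ball: "cball (c, a / 2) (a / 2) \<subseteq> UNIV \<times> {0..a}" for c :: real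
  proof
    fix z :: "real \<times> real" assume "z \<in> cball (c, a / 2) (a / 2)"
    then have "dist (a / 2) (snd z) \<le> a / 2" using dist_snd_le[of "(c, a / 2)" z] by simp
    then have "0 \<le> snd z" "snd z \<le> a" by (auto simp: dist_real_def abs_if split: if_splits)
    then show "z \<in> UNIV \<times> {0..a}" by (cases z) auto
  qed
  then have "?U \<subseteq> UNIV \<times> {0..a}" by blast
  then have "stadium L a \<subseteq> interior (UNIV \<times> {0..a})" unfolding stadium_def by (rule interior_mono)
  then show "stadium L a \<subseteq> UNIV \<times> {0<..<a}" by (simp add: interior_Times)
  show "{0<..<L} \<times> {0<..<a} \<subseteq> stadium L a"
    unfolding stadium_def by (rule interior_maximal) (auto intro: open_Times)
qed (use assms in auto)

theorem mainTheorem1: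
  fixes L a \<alpha> \<beta> :: real
  assumes "L > 0" and "a > 0"
    and "0 < \<alpha>" and "\<alpha> < \<beta>" and "\<beta> < L"
  shows "\<exists>C::real. \<forall>k\<ge>0. \<forall>f\<in>L2 (stadium L a). \<forall>v\<in>H10 (stadium L a).
     helmholtz_distributional (stadium L a) k v f \<longrightarrow>
       (\<integral>z. (cmod (v z))\<^sup>2 \<partial>lebesgue_on (stadium L a))
         \<le> C * ((\<integral>z. (cmod (f z))\<^sup>2 \<partial>lebesgue_on (stadium L a))
              + (\<integral>z. (cmod (v z))\<^sup>2 \<partial>lebesgue_on (stadium L a - {\<alpha>..\<beta>} \<times> {0..a})))"
proof -
  interpret strip_domain "stadium L a" L a
    by (rule stadium_strip_domain[OF assms(1,2)])
  show ?thesis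
    by (rule control_from_complement_of_rectangle[OF assms(3-5)]) blast
qed

end
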